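(* Let $\mathcal X=(X_t)_{t\ge0}$, $X_t=\overline{(U_t,r_t,\mu_t)}$, be the tree-valued Fleming–Viot process (arbitrary mutation parameters, selection intensity $\alpha\ge0$ and fitness function, arbitrary initial law on $\mathbb U_A$). Then $$\mathbf P(\mu_t\text{ has no atoms for all } t>0)=1.$$
   Context: Fix a compact metric space $A$. An $A$-marked metric measure space is $(U,r,\mu)$ with $(U,r)$ complete separable (ultra)metric and $\mu$ a probability measure on $U\times A$; $\mathbb U_A$ is the space of equivalence classes (isometries between supports of $U$-marginals preserving $\mu$) with the marked Gromov-weak topology. The tree-valued Fleming–Viot process is the unique continuous solution of the martingale problem with generator $\Omega=\Omega^{\rm grow}+\Omega^{\rm res}+\Omega^{\rm mut}+\Omega^{\rm sel}$ acting on $\Phi^\phi=\int\phi((r(u_i,u_j))_{i<j},(a_i)_i)d\mu^{\otimes\mathbb N}$ ($\phi$ bounded measurable, depending on first $n$ points, $C^1_b$ in distances): $\Omega^{\rm grow}\Phi=\langle\mu^{\otimes\mathbb N},\sum_{i<j}\partial\phi/\partial r_{ij}\rangle$; $\Omega^{\rm res}\Phi=\tfrac12\sum_{k,\ell=1}^n\langle\mu^{\otimes\mathbb N},\phi\circ\theta_{k,\ell}-\phi\rangle$, $\theta_{k,\ell}$ replacing sample individual $\ell$ by a copy of $k$ ($r_{i\ell}\mapsto r_{ik}$, $r_{kk}=0$, $a_\ell\mapsto a_k$); $\Omega^{\rm mut}\Phi=\vartheta\sum_{k=1}^n\langle\mu^{\otimes\mathbb N},\int\phi(\underline{\underline r},\underline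 a^{k,b})\beta(a_k,db)-\phi\rangle$ ($\vartheta\ge0$, $\beta$ Markov kernel on $A$); $\Omega^{\rm sel}\Phi=\alpha\sum_{k=1}^n\langle\mu^{\otimes\mathbb N},\phi\,\chi'(a_k,a_{n+1},r_{k,n+1})-\phi\,\chi'(a_{n+1},a_{n+2},r_{n+1,n+2})\rangle$ with $\chi':A\times A\times[0,\infty)\to[0,1]$ symmetric in first two arguments, continuous, $C^1$ in the third. "No atoms" is a property of the class: there is no point of positive mass, equivalently $\int\mu_t^{\otimes2}\mathbf 1\{r_t(u_1,u_2)=0\}=0$. *)

theory Defs
  imports "HOL-Probability.Probability"
begin

text \<open>A representative of an element of U_A: a metric r on the point type 'u and a
probability measure mu on 'u x A.  Separability of the support is required
(a countable set D which is mu-almost everywhere dense); completeness is not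
needed since a space and its completion define the same equivalence class.\<close>

definition mmm_space :: "('u \<Rightarrow> 'u \<Rightarrow> real) \<Rightarrow> ('u \<times> 'a::metric_space) measure \<Rightarrow> bool" where
  "mmm_space r \<mu> \<longleftrightarrow>
     prob_space \<mu> \<and>
     (\<forall>u v. r u v = r v u) \<and> (\<forall>u. r u u = 0) \<and> (\<forall>u v. r u v = 0 \<longrightarrow> u = v) \<and>
     (\<forall>u v w. r u w \<le> r u v + r v w) \<and>
     snd \<in> \<mu> \<rightarrow>\<^sub>M borel \<and>
     (\<lambda>(x, y). r (fst x) (fst y)) \<in> borel_measurable (\<mu> \<Otimes>\<^sub>M \<mu>) \<and>
     (\<exists>D. countable D \<and> (\<forall>d\<in>D. (\<lambda>x. r (fst x) d) \<in> borel_measurable \<mu>) \<and>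
        (\<forall>\<epsilon>>0. emeasure \<mu> {x\<in>space \<mu>. \<exists>d\<in>D. r (fst x) d < \<epsilon>} = 1))"

definition no_atoms :: "('u \<Rightarrow> 'u \<Rightarrow> real) \<times> ('u \<times> 'a) measure \<Rightarrow> bool" where
  "no_atoms X \<longleftrightarrow>
     measure (snd X \<Otimes>\<^sub>M snd X) {p \<in> space (snd X \<Otimes>\<^sub>M snd X). fst X (fst (fst p)) (fst (snd p)) = 0} = 0"

text \<open>Test functions act on (distance matrix, mark sequence); indices start at 0, so
"depending on the first n points" means on r_ij with i < j < n and a_i with i < n.\<close>

definition sample_space :: "((nat \<Rightarrow> nat \<Rightarrow> real) \<times> (nat \<Rightarrow> 'a::topological_space)) measure" where
  "sample_space = (PiM UNIV (\<lambda>_. PiM UNIV (\<lambda>_. (borel :: real measure)))) \<Otimes>\<^sub>M (PiM UNIV (\<lambda>_. (borel :: 'a measure)))"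

definition sample :: "('u \<Rightarrow> 'u \<Rightarrow> real) \<Rightarrow> (nat \<Rightarrow> 'u \<times> 'a) \<Rightarrow> (nat \<Rightarrow> nat \<Rightarrow> real) \<times> (nat \<Rightarrow> 'a)" where
  "sample r x = ((\<lambda>i j. r (fst (x i)) (fst (x j))), (\<lambda>i. snd (x i)))"

definition Phi :: "((nat \<Rightarrow> nat \<Rightarrow> real) \<times> (nat \<Rightarrow> 'a) \<Rightarrow> real) \<Rightarrow>
                   ('u \<Rightarrow> 'u \<Rightarrow> real) \<times> ('u \<times> 'a) measure \<Rightarrow> real" where
  "Phi \<phi> X = (\<integral>x. \<phi> (sample (fst X) x) \<partial>(PiM UNIV (\<lambda>_. snd X)))"

definition depends_first :: "nat \<Rightarrow> ((nat \<Rightarrow> nat \<Rightarrow> real) \<times> (nat \<Rightarrow> 'a) \<Rightarrow> real) \<Rightarrow> bool" where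
  "depends_first n \<phi> \<longleftrightarrow>
     (\<forall>rr rr' aa aa'. (\<forall>i j. i < j \<and> j < n \<longrightarrow> rr i j = rr' i j) \<and> (\<forall>i<n. aa i = aa' i)
        \<longrightarrow> \<phi> (rr, aa) = \<phi> (rr', aa'))"

definition upd_dist :: "(nat \<Rightarrow> nat \<Rightarrow> real) \<Rightarrow> nat \<Rightarrow> nat \<Rightarrow> real \<Rightarrow> (nat \<Rightarrow> nat \<Rightarrow> real)" where
  "upd_dist rr i j s = rr(i := (rr i)(j := s))"

definition pderiv_dist :: "((nat \<Rightarrow> nat \<Rightarrow> real) \<times> (nat \<Rightarrow> 'a) \<Rightarrow> real) \<Rightarrow> nat \<Rightarrow> nat \<Rightarrow>
                           (nat \<Rightarrow> nat \<Rightarrow> real) \<times> (nat \<Rightarrow> 'a) \<Rightarrow> real" where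
  "pderiv_dist \<phi> i j z = deriv (\<lambda>s. \<phi> (upd_dist (fst z) i j s, snd z)) (fst z i j)"

definition C1b_dist :: "nat \<Rightarrow> ((nat \<Rightarrow> nat \<Rightarrow> real) \<times> (nat \<Rightarrow> 'a) \<Rightarrow> real) \<Rightarrow> bool" where
  "C1b_dist n \<phi> \<longleftrightarrow>
     (\<forall>i j. i < j \<and> j < n \<longrightarrow>
        (\<forall>rr aa s. (\<lambda>s. \<phi> (upd_dist rr i j s, aa)) field_differentiable (at s)) \<and>
        bounded (range (pderiv_dist \<phi> i j)) \<and>
        (\<forall>aa. continuous_on UNIV (\<lambda>rr. pderiv_dist \<phi> i j (rr, aa))))"

definition test_fun :: "nat \<Rightarrow> ((nat \<Rightarrow> nat \<Rightarrow> real) \<times> (nat \<Rightarrow> 'a::topological_space) \<Rightarrow> real) \<Rightarrow> bool" where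
  "test_fun n \<phi> \<longleftrightarrow> \<phi> \<in> borel_measurable sample_space \<and> bounded (range \<phi>) \<and>
                      depends_first n \<phi> \<and> C1b_dist n \<phi>"

definition bm_fun :: "nat \<Rightarrow> ((nat \<Rightarrow> nat \<Rightarrow> real) \<times> (nat \<Rightarrow> 'a::topological_space) \<Rightarrow> real) \<Rightarrow> bool" where
  "bm_fun n \<phi> \<longleftrightarrow> \<phi> \<in> borel_measurable sample_space \<and> bounded (range \<phi>) \<and> depends_first n \<phi>"

text \<open>Bounded continuous finite-dimensional functions: they induce the marked Gromov-weak topology.\<close>
definition cont_fun :: "nat \<Rightarrow> ((nat \<Rightarrow> nat \<Rightarrow> real) \<times> (nat \<Rightarrow> 'a::topological_space) \<Rightarrow> real) \<Rightarrow> bool" where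
  "cont_fun n \<phi> \<longleftrightarrow> bm_fun n \<phi> \<and> continuous_on UNIV \<phi>"

definition resample :: "nat \<Rightarrow> nat \<Rightarrow> (nat \<Rightarrow> nat \<Rightarrow> real) \<times> (nat \<Rightarrow> 'a) \<Rightarrow> (nat \<Rightarrow> nat \<Rightarrow> real) \<times> (nat \<Rightarrow> 'a)" where
  "resample k l z =
     (let sw = (\<lambda>i. if i = l then k else i) in
      ((\<lambda>i j. if i \<noteq> j \<and> sw i = sw j then 0 else fst z (sw i) (sw j)), (\<lambda>i. snd z (sw i))))"

definition mutate :: "nat \<Rightarrow> 'a \<Rightarrow> (nat \<Rightarrow> nat \<Rightarrow> real) \<times> (nat \<Rightarrow> 'a) \<Rightarrow> (nat \<Rightarrow> nat \<Rightarrow> real) \<times> (nat \<Rightarrow> 'a)" where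
  "mutate k b z = (fst z, (snd z)(k := b))"

definition gen_grow where
  "gen_grow \<phi> n X = Phi (\<lambda>z. \<Sum>j<n. \<Sum>i<j. pderiv_dist \<phi> i j z) X"

definition gen_res where
  "gen_res \<phi> n X = 1/2 * (\<Sum>k<n. \<Sum>l<n. Phi (\<lambda>z. \<phi> (resample k l z) - \<phi> z) X)"

definition gen_mut where
  "gen_mut \<theta> \<beta> \<phi> n X = \<theta> * (\<Sum>k<n. Phi (\<lambda>z. (\<integral>b. \<phi> (mutate k b z) \<partial>(\<beta> (snd z k))) - \<phi> z) X)"

definition gen_sel where
  "gen_sel \<alpha> fit \<phi> n X = \<alpha> * (\<Sum>k<n. Phi (\<lambda>z. \<phi> z * fit (snd z k) (snd z n) (fst z k n)
                                       - \<phi> z * fit (snd z n) (snd z (Suc n)) (fst z n (Suc n))) X)"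

definition generator where
  "generator \<theta> \<beta> \<alpha> fit \<phi> n X = gen_grow \<phi> n X + gen_res \<phi> n X + gen_mut \<theta> \<beta> \<phi> n X + gen_sel \<alpha> fit \<phi> n X"

definition fitness_fun :: "('a::metric_space \<Rightarrow> 'a \<Rightarrow> real \<Rightarrow> real) \<Rightarrow> bool" where
  "fitness_fun fit \<longleftrightarrow>
     (\<forall>a b r. fit a b r = fit b a r) \<and>
     (\<forall>a b r. 0 \<le> r \<longrightarrow> 0 \<le> fit a b r \<and> fit a b r \<le> 1) \<and>
     continuous_on (UNIV \<times> UNIV \<times> {0..}) (\<lambda>(a, b, r). fit a b r) \<and>
     (\<forall>a b. \<exists>D. continuous_on {0..} D \<and>
        (\<forall>r\<ge>0. ((fit a b) has_real_derivative D r) (at r within {0..})))"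

definition nat_filtration where
  "nat_filtration M X s =
     sigma (space M) {f -` B \<inter> space M | f B.
        (\<exists>u n \<psi>. 0 \<le> u \<and> u \<le> s \<and> test_fun n \<psi> \<and> f = (\<lambda>\<omega>. Phi \<psi> (X u \<omega>))) \<and> B \<in> sets borel}"

definition TFV_solution ::
  "'w measure \<Rightarrow> real \<Rightarrow> ('a::metric_space \<Rightarrow> 'a measure) \<Rightarrow> real \<Rightarrow> ('a \<Rightarrow> 'a \<Rightarrow> real \<Rightarrow> real) \<Rightarrow>
   (real \<Rightarrow> 'w \<Rightarrow> ('u \<Rightarrow> 'u \<Rightarrow> real) \<times> ('u \<times> 'a) measure) \<Rightarrow> bool" where
  "TFV_solution M \<theta> \<beta> \<alpha> fit X \<longleftrightarrow>
     prob_space M \<and>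
     \<comment> \<open>states are (representatives of) A-marked metric measure spaces\<close>
     (\<forall>t\<ge>0. \<forall>\<omega>\<in>space M. mmm_space (fst (X t \<omega>)) (snd (X t \<omega>))) \<and>
     \<comment> \<open>measurable process\<close>
     (\<forall>n \<psi>. bm_fun n \<psi> \<longrightarrow>
        (\<lambda>(t, \<omega>). Phi \<psi> (X t \<omega>)) \<in> borel_measurable (restrict_space lborel {0..} \<Otimes>\<^sub>M M) \<and>
        (\<forall>t\<ge>0. (\<lambda>\<omega>. Phi \<psi> (X t \<omega>)) \<in> borel_measurable M)) \<and>
     \<comment> \<open>almost surely continuous paths in the marked Gromov-weak topology\<close>
     (AE \<omega> in M. \<forall>n \<phi>. cont_fun n \<phi> \<longrightarrow> continuous_on {0..} (\<lambda>t. Phi \<phi> (X t \<omega>))) \<and>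
     \<comment> \<open>martingale problem w.r.t. the natural filtration\<close>
     (\<forall>n \<phi>. test_fun n \<phi> \<longrightarrow>
        (let Mg = (\<lambda>t \<omega>. Phi \<phi> (X t \<omega>) - Phi \<phi> (X 0 \<omega>)
                      - (LINT \<tau>:{0..t}|lborel. generator \<theta> \<beta> \<alpha> fit \<phi> n (X \<tau> \<omega>))) in
         (\<forall>t\<ge>0. integrable M (Mg t) \<and> Mg t \<in> borel_measurable (nat_filtration M X t)) \<and>
         (\<forall>s t. 0 \<le> s \<longrightarrow> s \<le> t \<longrightarrow> (\<forall>B \<in> sets (nat_filtration M X s).
             (\<integral>\<omega>. indicator B \<omega> * (Mg t \<omega> - Mg s \<omega>) \<partial>M) = 0))))"

end

theory Submission
  imports Defs
begin

text \<open>
Let $f_c(s) = 1 - \tanh (c s)$, which for $s \ge 0$ decreases to the indicator of $s = 0$ as $c \to \infty$,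
and for a state $(U, r, \mu)$ let $Y$ and $V$ be the integrals of $f_c(r_{01})$ and of
$f_c(r_{01}) f_c(r_{02})$. Tree growth contributes at most $-cY$ to the drift of $Y$, so that its
drift is at most $1 - (c - 2\alpha) Y$ and $\int_0^T E\,Y_t\,dt \le (T+1)/(c - 2\alpha)$.
The drift of $Y$ itself is not small, but every resampling event in the three-point functional $V$
leaves at least one factor $f_c$, whence the drift of $V$ is at most $(3 + 3\alpha) Y$.
A maximal inequality for $V$, started at a time $s$ and averaged over $s \in (0, \epsilon]$, then
bounds $P(\sup_{[\epsilon, T]} V \ge \delta)$ by a constant times $1/(c - 2\alpha)$.
Finally $V \ge \mu^{\otimes 3}(r_{01} = r_{02} = 0)$ for every $c$, and this mass vanishes only if
$\mu$ has no atoms.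
\<close>

section \<open>Measurability on the sample space\<close>

lemma compact_UNIV_countable_base:
  assumes "compact (UNIV :: 'a::metric_space set)"
  obtains \<B> :: "'a::metric_space set set" where "countable \<B>" "\<And>b. b \<in> \<B> \<Longrightarrow> open b"
    "\<And>U x. open U \<Longrightarrow> x \<in> U \<Longrightarrow> \<exists>b\<in>\<B>. x \<in> b \<and> b \<subseteq> U"
proof -
  have "\<exists>k. finite k \<and> (UNIV :: 'a set) \<subseteq> (\<Union>x\<in>k. ball x (1 / real (Suc n)))" for n
    using assms unfolding compact_eq_totally_bounded by simp
  then have "\<forall>n. \<exists>k. finite k \<and> (UNIV :: 'a set) \<subseteq> (\<Union>x\<in>k. ball x (1 / real (Suc n)))" by blast
  from choice[OF this] obtain k :: "nat \<Rightarrow> 'a set" where k: "\<And>n. finite (k n)"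
    "\<And>n. UNIV \<subseteq> (\<Union>x\<in>k n. ball x (1 / real (Suc n)))"
    by blast
  define \<B> where "\<B> = (\<Union>n. (\<lambda>x. ball x (1 / real (Suc n))) ` k n)"
  show thesis
  proof
    show "countable \<B>" unfolding \<B>_def using k(1) by (auto intro: countable_finite)
    show "open b" if "b \<in> \<B>" for b using that by (auto simp: \<B>_def)
    fix U :: "'a set" and x assume "open U" "x \<in> U"
    then obtain e where e: "e > 0" "ball x e \<subseteq> U" by (meson open_contains_ball)
    obtain n where n: "1 / real (Suc n) < e / 2"
      using reals_Archimedean[of "e / 2"] e by (auto simp: inverse_eq_divide)
    obtain d where d: "d \<in> k n" "x \<in> ball d (1 / real (Suc n))" using k(2)[of n] by blast
    have "ball d (1 / real (Suc n)) \<subseteq> ball x e"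
    proof
      fix y assume "y \<in> ball d (1 / real (Suc n))"
      then have "dist d y < e / 2" "dist d x < e / 2" using n d(2) by auto
      then show "y \<in> ball x e" using dist_triangle_half_r[of d x e y] by simp
    qed
    then show "\<exists>b\<in>\<B>. x \<in> b \<and> b \<subseteq> U" using d e by (intro bexI[of _ "ball d (1 / real (Suc n))"]) (auto simp: \<B>_def)
  qed
qed

lemma open_in_sets_pair_borel:
  fixes U :: "('a::metric_space \<times> 'b::topological_space) set"
  assumes "compact (UNIV :: 'a set)" "open U"
  shows "U \<in> sets (borel \<Otimes>\<^sub>M borel)"
proof -
  obtain \<B> :: "'a set set" where B: "countable \<B>" "\<And>b. b \<in> \<B> \<Longrightarrow> open b"
    "\<And>U x. open U \<Longrightarrow> x \<in> U \<Longrightarrow> \<exists>b\<in>\<B>. x \<in> b \<and> b \<subseteq> U"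
    using compact_UNIV_countable_base[OF assms(1)] by metis
  have "U = (\<Union>b\<in>\<B>. b \<times> \<Union>{V. open V \<and> b \<times> V \<subseteq> U})"
  proof (intro equalityI subsetI)
    fix p assume "p \<in> U"
    then obtain A V where AV: "open A" "open V" "p \<in> A \<times> V" "A \<times> V \<subseteq> U"
      using open_prod_elim[OF assms(2)] by metis
    moreover obtain b where "b \<in> \<B>" "fst p \<in> b" "b \<subseteq> A" using B(3)[OF AV(1)] AV(3) by (metis mem_Times_iff)
    ultimately show "p \<in> (\<Union>b\<in>\<B>. b \<times> \<Union>{V. open V \<and> b \<times> V \<subseteq> U})"
      by (auto intro!: bexI[of _ b] exI[of _ V])
  qed auto
  also have "\<dots> \<in> sets (borel \<Otimes>\<^sub>M borel)"
    using B(2) by (intro sets.countable_UN' B(1) pair_measureI) (auto intro!: borel_open)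
  finally show ?thesis .
qed

lemma measurable_id_pair_borel:
  assumes "compact (UNIV :: 'a::metric_space set)"
  shows "(\<lambda>p. p) \<in> (borel \<Otimes>\<^sub>M borel) \<rightarrow>\<^sub>M (borel :: ('a::metric_space \<times> 'b::topological_space) measure)"
  using open_in_sets_pair_borel[OF assms] by (intro borel_measurableI) (simp add: space_pair_measure)

lemma fitness_measurable:
  fixes fit :: "'a::metric_space \<Rightarrow> 'a \<Rightarrow> real \<Rightarrow> real"
  assumes "compact (UNIV :: 'a set)" "fitness_fun fit"
  shows "(\<lambda>(a, b, s). fit a b (max 0 s)) \<in> borel_measurable (borel \<Otimes>\<^sub>M borel \<Otimes>\<^sub>M borel)"
proof -
  have "continuous_on UNIV ((\<lambda>(a, b, r). fit a b r) \<circ> (\<lambda>(a, b, s). (a, b, max 0 s)))"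
    using assms(2) unfolding fitness_fun_def case_prod_beta
    by (intro continuous_on_compose continuous_intros) (auto elim!: continuous_on_subset)
  then have "continuous_on UNIV (\<lambda>(a, b, s). fit a b (max 0 s))"
    by (simp add: o_def case_prod_beta)
  then have "(\<lambda>(a, b, s). fit a b (max 0 s)) \<in> borel_measurable borel"
    by (rule borel_measurable_continuous_onI)
  have "(\<lambda>p. (fst p, snd p)) \<in> (borel \<Otimes>\<^sub>M borel \<Otimes>\<^sub>M borel) \<rightarrow>\<^sub>M ((borel :: 'a measure) \<Otimes>\<^sub>M (borel :: ('a \<times> real) measure))"
    by (intro measurable_Pair measurable_fst measurable_compose[OF measurable_snd measurable_id_pair_borel[OF assms(1)]])
  from measurable_compose[OF measurable_compose[OF this measurable_id_pair_borel[OF assms(1)]]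
      \<open>(\<lambda>(a, b, s). fit a b (max 0 s)) \<in> borel_measurable borel\<close>]
  show ?thesis by simp
qed

lemma measurable_dist_entry [measurable]: "(\<lambda>z. fst z i j) \<in> borel_measurable sample_space"
proof -
  have "(\<lambda>z. fst z i) \<in> sample_space \<rightarrow>\<^sub>M PiM UNIV (\<lambda>_. borel :: real measure)"
    unfolding sample_space_def by measurable
  then show ?thesis by (rule measurable_compose) simp
qed

lemma measurable_mark_entry [measurable]: "(\<lambda>z. snd z i) \<in> sample_space \<rightarrow>\<^sub>M borel"
  unfolding sample_space_def by measurable

lemma measurable_into_sample_space:
  assumes "\<And>i j. (\<lambda>x. R x i j) \<in> borel_measurable N" "\<And>i. (\<lambda>x. a x i) \<in> N \<rightarrow>\<^sub>M borel"
  shows "(\<lambda>x. (R x, a x)) \<in> N \<rightarrow>\<^sub>M sample_space"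
  unfolding sample_space_def
  by (intro measurable_Pair measurable_abs_UNIV assms)

lemma measurable_resample [measurable]: "resample k l \<in> sample_space \<rightarrow>\<^sub>M sample_space"
  unfolding resample_def Let_def by (intro measurable_into_sample_space) auto

lemma measurable_upd_dist:
  assumes [measurable]: "f \<in> borel_measurable sample_space"
  shows "(\<lambda>z. (upd_dist (fst z) i j (f z), snd z)) \<in> sample_space \<rightarrow>\<^sub>M sample_space"
proof (intro measurable_into_sample_space)
  show "(\<lambda>z. upd_dist (fst z) i j (f z) k l) \<in> borel_measurable sample_space" for k l
    by (cases "k = i"; cases "l = j") (simp_all add: upd_dist_def)
qed simp

lemma upd_dist_same [simp]: "upd_dist rr i j (rr i j) = rr"
  by (simp add: upd_dist_def)

lemma measurable_pderiv_dist:
  assumes [measurable]: "\<phi> \<in> borel_measurable sample_space" 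
    and "\<And>rr aa s. (\<lambda>s. \<phi> (upd_dist rr i j s, aa)) field_differentiable (at s)"
  shows "pderiv_dist \<phi> i j \<in> borel_measurable sample_space"
proof (rule borel_measurable_LIMSEQ_metric)
  define h where "h n z = (\<phi> (upd_dist (fst z) i j (fst z i j + 1 / real (Suc n)), snd z) - \<phi> z) * real (Suc n)" for n and z :: "(nat \<Rightarrow> nat \<Rightarrow> real) \<times> (nat \<Rightarrow> 'a)"
  note [measurable] = measurable_upd_dist
  show "h n \<in> borel_measurable sample_space" for n
    unfolding h_def[abs_def] by measurable
  fix z :: "(nat \<Rightarrow> nat \<Rightarrow> real) \<times> (nat \<Rightarrow> 'a)"
  let ?g = "\<lambda>s. \<phi> (upd_dist (fst z) i j s, snd z)"
  have "(?g has_real_derivative pderiv_dist \<phi> i j z) (at (fst z i j))"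
    unfolding pderiv_dist_def using assms(2) by (rule field_differentiable_derivI)
  then have "((\<lambda>e. (?g (fst z i j + e) - ?g (fst z i j)) / e) \<longlongrightarrow> pderiv_dist \<phi> i j z) (at 0)"
    by (simp add: DERIV_def)
  moreover have "filterlim (\<lambda>n. 1 / real (Suc n)) (at 0) sequentially"
    by (intro filterlim_atI) (use LIMSEQ_inverse_real_of_nat in \<open>auto simp: inverse_eq_divide\<close>)
  ultimately have "(\<lambda>n. (?g (fst z i j + 1 / real (Suc n)) - ?g (fst z i j)) / (1 / real (Suc n))) \<longlonglongrightarrow> pderiv_dist \<phi> i j z"
    by (rule filterlim_compose)
  then show "(\<lambda>n. h n z) \<longlonglongrightarrow> pderiv_dist \<phi> i j z"
    by (simp add: h_def)
qed

definition clean :: "(nat \<Rightarrow> nat \<Rightarrow> real) \<times> (nat \<Rightarrow> 'a) \<Rightarrow> (nat \<Rightarrow> nat \<Rightarrow> real) \<times> (nat \<Rightarrow> 'a)" where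
  "clean z = ((\<lambda>i j. if i = j then 0 else max 0 (fst z (min i j) (max i j))), snd z)"

lemma clean_clean [simp]: "clean (clean z) = clean z"
  by (auto simp: clean_def min_def max_def fun_eq_iff)

lemma snd_clean [simp]: "snd (clean z) = snd z"
  by (simp add: clean_def)

lemma clean_dist_nonneg: "fst (clean z) i j \<ge> 0"
  by (simp add: clean_def)

lemma clean_dist_sym: "fst (clean z) i j = fst (clean z) j i"
  by (simp add: clean_def min.commute max.commute)

lemma clean_cong:
  assumes "\<forall>i j. i < j \<and> j < n \<longrightarrow> rr i j = rr' i j" "i < n" "j < n"
  shows "fst (clean (rr, aa)) i j = fst (clean (rr', aa')) i j"
  using assms by (auto simp: clean_def min_def max_def)

lemma measurable_clean [measurable]: "clean \<in> sample_space \<rightarrow>\<^sub>M sample_space"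
  unfolding clean_def by (intro measurable_into_sample_space) auto

definition bounded_borel :: "'b measure \<Rightarrow> ('b \<Rightarrow> real) \<Rightarrow> bool" where
  "bounded_borel N f \<longleftrightarrow> f \<in> borel_measurable N \<and> (\<exists>K. \<forall>z. \<bar>f z\<bar> \<le> K)"

lemma bounded_borelI: "f \<in> borel_measurable N \<Longrightarrow> (\<And>z. \<bar>f z\<bar> \<le> K) \<Longrightarrow> bounded_borel N f"
  by (auto simp: bounded_borel_def)

lemma bounded_borel_iff: "bounded_borel N f \<longleftrightarrow> f \<in> borel_measurable N \<and> bounded (range f)"
  by (auto simp: bounded_borel_def bounded_iff)

lemma bounded_borel_const [simp, intro]: "bounded_borel N (\<lambda>_. c)"
  by (rule bounded_borelI[where K="\<bar>c\<bar>"]) auto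

lemma bounded_borel_add [intro]:
  assumes "bounded_borel N f" "bounded_borel N g" shows "bounded_borel N (\<lambda>z. f z + g z)"
proof -
  obtain K L where "\<And>z. \<bar>f z\<bar> \<le> K" "\<And>z. \<bar>g z\<bar> \<le> L" using assms by (auto simp: bounded_borel_def)
  then have "\<bar>f z + g z\<bar> \<le> K + L" for z by (meson abs_triangle_ineq add_mono order_trans)
  then show ?thesis using assms by (intro bounded_borelI) (auto simp: bounded_borel_def)
qed

lemma bounded_borel_mult [intro]:
  assumes "bounded_borel N f" "bounded_borel N g" shows "bounded_borel N (\<lambda>z. f z * g z)"
proof -
  obtain K L where "\<And>z. \<bar>f z\<bar> \<le> K" "\<And>z. \<bar>g z\<bar> \<le> L" using assms by (auto simp: bounded_borel_def)
  then have "\<bar>f z * g z\<bar> \<le> K * L" for z by (simp add: abs_mult mult_mono')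
  then show ?thesis using assms by (intro bounded_borelI) (auto simp: bounded_borel_def)
qed

lemma bounded_borel_diff [intro]:
  assumes "bounded_borel N f" "bounded_borel N g" shows "bounded_borel N (\<lambda>z. f z - g z)"
  using bounded_borel_add[OF assms(1) bounded_borel_mult[OF bounded_borel_const[of _ "-1"] assms(2)]] by simp

lemma bounded_borel_sum [intro]:
  "(\<And>i. i \<in> I \<Longrightarrow> bounded_borel N (f i)) \<Longrightarrow> bounded_borel N (\<lambda>z. \<Sum>i\<in>I. f i z)"
  by (induction I rule: infinite_finite_induct) auto

lemma bounded_borel_compose:
  assumes "bounded_borel N f" "g \<in> N' \<rightarrow>\<^sub>M N" shows "bounded_borel N' (\<lambda>z. f (g z))"
  using assms by (auto simp: bounded_borel_def)

context
  fixes X :: "('u \<Rightarrow> 'u \<Rightarrow> real) \<times> ('u \<times> 'a::metric_space) measure"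
  assumes X: "mmm_space (fst X) (snd X)"
begin

lemma prob_space_sampling: "prob_space (PiM (UNIV :: nat set) (\<lambda>_. snd X))"
  using X by (intro prob_space_PiM) (auto simp: mmm_space_def)

lemma measurable_sample: "sample (fst X) \<in> PiM UNIV (\<lambda>_. snd X) \<rightarrow>\<^sub>M sample_space"
proof -
  have r: "(\<lambda>p. fst X (fst (fst p)) (fst (snd p))) \<in> borel_measurable (snd X \<Otimes>\<^sub>M snd X)"
    and [measurable]: "snd \<in> snd X \<rightarrow>\<^sub>M borel"
    using X by (auto simp: mmm_space_def case_prod_beta)
  have "(\<lambda>x. fst X (fst (x i)) (fst (x j))) \<in> borel_measurable (PiM UNIV (\<lambda>_. snd X))" for i j :: nat
    using measurable_compose[OF _ r, of "\<lambda>x. (x i, x j)" "PiM UNIV (\<lambda>_. snd X)"] by simp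
  then show ?thesis unfolding sample_def[abs_def]
    by (intro measurable_into_sample_space) simp_all
qed

lemma clean_sample: "clean (sample (fst X) x) = sample (fst X) x"
proof -
  have "fst X u v \<ge> 0" for u v
  proof -
    have "fst X u u \<le> fst X u v + fst X v u" "fst X u u = 0" "fst X v u = fst X u v"
      using X unfolding mmm_space_def by blast+
    then show ?thesis by linarith
  qed
  moreover have "fst X u v = fst X v u" "fst X u u = 0" for u v
    using X unfolding mmm_space_def by blast+
  ultimately show ?thesis
    by (auto simp: clean_def sample_def fun_eq_iff min_def max_def)
qed

lemma Phi_clean: "Phi (\<lambda>z. \<psi> (clean z)) X = Phi \<psi> X"
  by (simp add: Phi_def clean_sample)

lemma integrable_sample:
  assumes "bounded_borel sample_space \<psi>"
  shows "integrable (PiM UNIV (\<lambda>_. snd X)) (\<lambda>x. \<psi> (sample (fst X) x))"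
proof -
  interpret prob_space "PiM (UNIV :: nat set) (\<lambda>_. snd X)" by (rule prob_space_sampling)
  obtain K where "\<And>z. \<bar>\<psi> z\<bar> \<le> K" using assms by (auto simp: bounded_borel_def)
  then show ?thesis using assms measurable_compose[OF measurable_sample]
    by (intro integrable_const_bound[where B=K]) (auto simp: bounded_borel_def)
qed

lemma Phi_mono:
  assumes "bounded_borel sample_space \<psi>" "bounded_borel sample_space \<psi>'" "\<And>z. \<psi> (clean z) \<le> \<psi>' (clean z)"
  shows "Phi \<psi> X \<le> Phi \<psi>' X"
  unfolding Phi_def using assms(1,2)
proof (intro integral_mono integrable_sample)
  show "\<psi> (sample (fst X) x) \<le> \<psi>' (sample (fst X) x)" for x
    using assms(3)[of "sample (fst X) x"] by (simp add: clean_sample)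
qed

lemma Phi_add:
  assumes "bounded_borel sample_space \<psi>" "bounded_borel sample_space \<psi>'"
  shows "Phi (\<lambda>z. \<psi> z + \<psi>' z) X = Phi \<psi> X + Phi \<psi>' X"
  unfolding Phi_def using assms by (simp add: integrable_sample)

lemma Phi_cmult: "Phi (\<lambda>z. c * \<psi> z) X = c * Phi \<psi> X"
  by (simp add: Phi_def)

lemma Phi_const: "Phi (\<lambda>z. c) X = c"
proof -
  interpret prob_space "PiM (UNIV :: nat set) (\<lambda>_. snd X)" by (rule prob_space_sampling)
  show ?thesis by (simp add: Phi_def prob_space)
qed

lemma Phi_sum:
  assumes "\<And>i. i \<in> I \<Longrightarrow> bounded_borel sample_space (\<psi> i)"
  shows "Phi (\<lambda>z. \<Sum>i\<in>I. \<psi> i z) X = (\<Sum>i\<in>I. Phi (\<psi> i) X)"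
  unfolding Phi_def using assms by (simp add: integrable_sample Bochner_Integration.integral_sum)

lemma Phi_abs_le:
  assumes "bounded_borel sample_space \<psi>" "\<And>z. \<bar>\<psi> z\<bar> \<le> K"
  shows "\<bar>Phi \<psi> X\<bar> \<le> K"
  using Phi_mono[of \<psi> "\<lambda>_. K"] Phi_mono[of "\<lambda>_. - K" \<psi>] assms by (auto simp: Phi_const abs_le_iff minus_le_iff)

lemma Phi_pair_exchange:
  assumes "i \<noteq> j" "g \<in> borel_measurable borel"
  shows "Phi (\<lambda>z. g (fst z i j)) X = Phi (\<lambda>z. g (fst z 0 1)) X"
proof -
  let ?P = "PiM (UNIV :: nat set) (\<lambda>_. snd X)"
  let ?p = "\<lambda>k::nat. if k = 0 then i else if k = 1 then j else k + i + j"
  have "inj ?p" using assms(1) by (auto simp: inj_on_def split: if_splits)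
  then have d: "distr ?P ?P (\<lambda>\<omega> k. \<omega> (?p k)) = ?P"
    using distr_PiM_reindex[of UNIV "\<lambda>_. snd X" ?p UNIV] X by (simp add: mmm_space_def restrict_UNIV)
  have m: "(\<lambda>x. g (fst (sample (fst X) x) 0 1)) \<in> borel_measurable ?P"
    using assms(2) measurable_compose[OF measurable_sample measurable_dist_entry] by simp
  have "Phi (\<lambda>z. g (fst z 0 1)) X = (\<integral>x. g (fst (sample (fst X) x) 0 1) \<partial>distr ?P ?P (\<lambda>\<omega> k. \<omega> (?p k)))"
    by (simp only: d Phi_def)
  also have "\<dots> = (\<integral>x. g (fst (sample (fst X) (\<lambda>k. x (?p k))) 0 1) \<partial>?P)"
    by (rule integral_distr[OF measurable_abs_UNIV m]) simp
  finally show ?thesis by (simp add: Phi_def sample_def)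
qed

end

section \<open>The generator as an integral over samples\<close>

definition agree_upto :: "nat \<Rightarrow> (nat \<Rightarrow> nat \<Rightarrow> real) \<times> (nat \<Rightarrow> 'a) \<Rightarrow> (nat \<Rightarrow> nat \<Rightarrow> real) \<times> (nat \<Rightarrow> 'a) \<Rightarrow> bool" where
  "agree_upto n w w' \<longleftrightarrow> (\<forall>i<n. \<forall>j<n. fst w i j = fst w' i j) \<and> (\<forall>i<n. snd w i = snd w' i)"

lemma depends_first_agree: "depends_first n \<phi> \<Longrightarrow> agree_upto n w w' \<Longrightarrow> \<phi> w = \<phi> w'"
  unfolding depends_first_def agree_upto_def
  by (cases w; cases w'; simp; meson less_trans)

lemma agree_upto_resample: "agree_upto n w w' \<Longrightarrow> k < n \<Longrightarrow> agree_upto n (resample k l w) (resample k l w')"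
  by (auto simp: agree_upto_def resample_def Let_def)

lemma agree_upto_upd_dist:
  "agree_upto n w w' \<Longrightarrow> agree_upto n (upd_dist (fst w) i j s, snd w) (upd_dist (fst w') i j s, snd w')"
  by (auto simp: agree_upto_def upd_dist_def)

lemma pderiv_dist_agree:
  assumes "depends_first n \<phi>" "agree_upto n w w'" "i < n" "j < n"
  shows "pderiv_dist \<phi> i j w = pderiv_dist \<phi> i j w'"
proof -
  have "fst w i j = fst w' i j" using assms by (simp add: agree_upto_def)
  moreover have "\<phi> (upd_dist (fst w) i j s, snd w) = \<phi> (upd_dist (fst w') i j s, snd w')" for s
    by (intro depends_first_agree[OF assms(1)] agree_upto_upd_dist assms(2))
  ultimately show ?thesis by (simp add: pderiv_dist_def)
qed

text \<open>Since sampled distance matrices are symmetric, nonnegative and vanish on the diagonal,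
composing with \<^const>\<open>clean\<close> does not change integrals, but it makes the integrand of the
generator a function of the entries above the diagonal only and hides the values of the
fitness function at negative distances, about which nothing is known.\<close>

definition gen_density :: "real \<Rightarrow> ('a \<Rightarrow> 'a \<Rightarrow> real \<Rightarrow> real) \<Rightarrow> ((nat \<Rightarrow> nat \<Rightarrow> real) \<times> (nat \<Rightarrow> 'a) \<Rightarrow> real) \<Rightarrow> nat \<Rightarrow>
    (nat \<Rightarrow> nat \<Rightarrow> real) \<times> (nat \<Rightarrow> 'a) \<Rightarrow> real" where
  "gen_density \<alpha> fit \<phi> n z =
     (\<Sum>j<n. \<Sum>i<j. pderiv_dist \<phi> i j (clean z))
     + 1/2 * (\<Sum>k<n. \<Sum>l<n. \<phi> (resample k l (clean z)) - \<phi> (clean z))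
     + \<alpha> * (\<Sum>k<n. \<phi> (clean z) * fit (snd z k) (snd z n) (fst (clean z) k n)
                 - \<phi> (clean z) * fit (snd z n) (snd z (Suc n)) (fst (clean z) n (Suc n)))"

context
  fixes fit :: "'a::metric_space \<Rightarrow> 'a \<Rightarrow> real \<Rightarrow> real" and n :: nat
    and \<phi> :: "(nat \<Rightarrow> nat \<Rightarrow> real) \<times> (nat \<Rightarrow> 'a) \<Rightarrow> real" and \<alpha> :: real
  assumes compact: "compact (UNIV :: 'a set)" and fit: "fitness_fun fit" and \<phi>: "test_fun n \<phi>"
begin

lemma bounded_borel_test_fun: "bounded_borel sample_space \<phi>"
  using \<phi> by (auto simp: test_fun_def bounded_borel_iff)

lemma bounded_borel_resampled: "bounded_borel sample_space (\<lambda>z. \<phi> (resample k l (clean z)) - \<phi> (clean z))"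
  by (intro bounded_borel_diff bounded_borel_compose[OF bounded_borel_test_fun]) measurable

lemma bounded_borel_pderiv:
  assumes "i < j" "j < n"
  shows "bounded_borel sample_space (\<lambda>z. pderiv_dist \<phi> i j (clean z))"
  using \<phi> assms
  by (intro bounded_borel_compose[OF _ measurable_clean])
    (auto simp: test_fun_def C1b_dist_def bounded_borel_iff intro!: measurable_pderiv_dist)

lemma bounded_borel_fit: "bounded_borel sample_space (\<lambda>z. fit (snd z k) (snd z l) (fst (clean z) i j))"
proof (rule bounded_borelI[where K=1])
  have "(\<lambda>z. fst (clean z :: _ \<times> (nat \<Rightarrow> 'a)) i j) \<in> borel_measurable sample_space"
    by (rule measurable_compose[OF measurable_clean measurable_dist_entry])
  then have "(\<lambda>z. (snd z k, snd z l, fst (clean z) i j)) \<in> sample_space \<rightarrow>\<^sub>M (borel \<Otimes>\<^sub>M borel \<Otimes>\<^sub>M borel)"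
    by (intro measurable_Pair) simp_all
  from measurable_compose[OF this fitness_measurable[OF compact fit]]
  show "(\<lambda>z. fit (snd z k) (snd z l) (fst (clean z) i j)) \<in> borel_measurable sample_space"
    by (simp add: max_absorb2 clean_dist_nonneg)
  show "\<bar>fit (snd z k) (snd z l) (fst (clean z) i j)\<bar> \<le> 1" for z
    using fit clean_dist_nonneg[of z i j] by (auto simp: fitness_fun_def abs_le_iff intro: order_trans[of _ 0])
qed

lemma bounded_borel_selected: "bounded_borel sample_space
  (\<lambda>z. \<phi> (clean z) * fit (snd z k) (snd z n) (fst (clean z) k n)
        - \<phi> (clean z) * fit (snd z n) (snd z (Suc n)) (fst (clean z) n (Suc n)))"
  by (intro bounded_borel_diff bounded_borel_mult bounded_borel_fit
      bounded_borel_compose[OF bounded_borel_test_fun measurable_clean])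

lemma bounded_borel_gen_density: "bounded_borel sample_space (gen_density \<alpha> fit \<phi> n)"
  unfolding gen_density_def[abs_def]
  by (intro bounded_borel_add bounded_borel_mult bounded_borel_sum bounded_borel_const
      bounded_borel_pderiv bounded_borel_resampled bounded_borel_selected) auto

lemma depends_first_gen_density: "depends_first (n + 2) (gen_density \<alpha> fit \<phi> n)"
  unfolding depends_first_def
proof (intro allI impI)
  fix rr rr' :: "nat \<Rightarrow> nat \<Rightarrow> real" and aa aa' :: "nat \<Rightarrow> 'a"
  assume *: "(\<forall>i j. i < j \<and> j < n + 2 \<longrightarrow> rr i j = rr' i j) \<and> (\<forall>i<n + 2. aa i = aa' i)"
  let ?z = "clean (rr, aa)" and ?z' = "clean (rr', aa')"
  have dep: "depends_first n \<phi>" using \<phi> by (simp add: test_fun_def)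
  have ag: "agree_upto (n + 2) ?z ?z'"
    using * clean_cong[of "n + 2" rr rr'] by (auto simp: agree_upto_def)
  then have ag': "agree_upto n ?z ?z'" by (auto simp: agree_upto_def)
  have "\<phi> ?z = \<phi> ?z'" by (rule depends_first_agree[OF dep ag'])
  moreover have "\<phi> (resample k l ?z) = \<phi> (resample k l ?z')" if "k < n" for k l
    by (rule depends_first_agree[OF dep agree_upto_resample[OF ag' that]])
  moreover have "pderiv_dist \<phi> i j ?z = pderiv_dist \<phi> i j ?z'" if "j < n" "i < j" for i j
    using that by (intro pderiv_dist_agree[OF dep ag']) auto
  moreover have "fst ?z i j = fst ?z' i j" if "i < n + 2" "j < n + 2" for i j
    using ag that by (auto simp: agree_upto_def)
  moreover have "aa i = aa' i" if "i < n + 2" for i using that * by simp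
  ultimately show "gen_density \<alpha> fit \<phi> n (rr, aa) = gen_density \<alpha> fit \<phi> n (rr', aa')"
    unfolding gen_density_def
    by (intro arg_cong2[where f="(+)"] arg_cong2[where f="(*)"] arg_cong2[where f="(-)"] sum.cong refl) auto
qed

lemma bm_fun_gen_density: "bm_fun (n + 2) (gen_density \<alpha> fit \<phi> n)"
  using bounded_borel_gen_density depends_first_gen_density by (simp add: bm_fun_def bounded_borel_iff)

lemma generator_eq_Phi:
  assumes X: "mmm_space (fst X) (snd X)" and \<beta>: "\<beta> \<in> borel \<rightarrow>\<^sub>M prob_algebra borel"
    and markfree: "\<And>k b z. \<phi> (mutate k b z) = \<phi> z"
  shows "generator \<theta> \<beta> \<alpha> fit \<phi> n X = Phi (gen_density \<alpha> fit \<phi> n) X"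
proof -
  have "prob_space (\<beta> a)" for a
    using measurable_space[OF \<beta>, of a] by (simp add: space_prob_algebra)
  then have "gen_mut \<theta> \<beta> \<phi> n X = 0"
    by (simp add: gen_mut_def markfree prob_space.prob_space Phi_const[OF X])
  moreover have "gen_grow \<phi> n X = Phi (\<lambda>z. \<Sum>j<n. \<Sum>i<j. pderiv_dist \<phi> i j (clean z)) X"
    unfolding gen_grow_def by (rule Phi_clean[OF X, symmetric])
  moreover have "gen_res \<phi> n X = Phi (\<lambda>z. 1/2 * (\<Sum>k<n. \<Sum>l<n. \<phi> (resample k l (clean z)) - \<phi> (clean z))) X"
  proof -
    have "Phi (\<lambda>z. \<phi> (resample k l z) - \<phi> z) X = Phi (\<lambda>z. \<phi> (resample k l (clean z)) - \<phi> (clean z)) X" for k l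
      by (rule Phi_clean[OF X, symmetric])
    then show ?thesis
      unfolding gen_res_def Phi_cmult[OF X]
      by (simp only: Phi_sum[OF X] bounded_borel_sum bounded_borel_resampled)
  qed
  moreover have "gen_sel \<alpha> fit \<phi> n X = Phi (\<lambda>z. \<alpha> * (\<Sum>k<n. \<phi> (clean z) * fit (snd z k) (snd z n) (fst (clean z) k n)
                 - \<phi> (clean z) * fit (snd z n) (snd z (Suc n)) (fst (clean z) n (Suc n)))) X"
  proof -
    have "Phi (\<lambda>z. \<phi> z * fit (snd z k) (snd z n) (fst z k n)
                 - \<phi> z * fit (snd z n) (snd z (Suc n)) (fst z n (Suc n))) X =
          Phi (\<lambda>z. \<phi> (clean z) * fit (snd z k) (snd z n) (fst (clean z) k n)
                 - \<phi> (clean z) * fit (snd z n) (snd z (Suc n)) (fst (clean z) n (Suc n))) X" for k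
      using Phi_clean[OF X, of "\<lambda>z. \<phi> z * fit (snd z k) (snd z n) (fst z k n)
                 - \<phi> z * fit (snd z n) (snd z (Suc n)) (fst z n (Suc n))"] by (simp only: snd_clean)
    then show ?thesis
      unfolding gen_sel_def Phi_cmult[OF X]
      by (simp only: Phi_sum[OF X] bounded_borel_selected)
  qed
  moreover have b:
    "bounded_borel sample_space (\<lambda>z. \<Sum>j<n. \<Sum>i<j. pderiv_dist \<phi> i j (clean z))"
    "bounded_borel sample_space (\<lambda>z. 1/2 * (\<Sum>k<n. \<Sum>l<n. \<phi> (resample k l (clean z)) - \<phi> (clean z)))"
    "bounded_borel sample_space (\<lambda>z. \<alpha> * (\<Sum>k<n. \<phi> (clean z) * fit (snd z k) (snd z n) (fst (clean z) k n)
                 - \<phi> (clean z) * fit (snd z n) (snd z (Suc n)) (fst (clean z) n (Suc n))))"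
    by (intro bounded_borel_mult bounded_borel_sum bounded_borel_const
        bounded_borel_pderiv bounded_borel_resampled bounded_borel_selected; simp)+
  ultimately show ?thesis
    unfolding generator_def gen_density_def[abs_def]
    by (simp only: Phi_add[OF X bounded_borel_add[OF b(1,2)] b(3)] Phi_add[OF X b(1,2)] add_0_right)
qed

end

section \<open>Test functions concentrating at distance zero\<close>

definition decay :: "real \<Rightarrow> real \<Rightarrow> real" where
  "decay c s = 1 - tanh (c * s)"

lemma decay_0 [simp]: "decay c 0 = 1"
  by (simp add: decay_def)

lemma decay_pos: "0 < decay c s"
  using tanh_real_lt_1[of "c * s"] by (simp add: decay_def)

lemma decay_less_2: "decay c s < 2"
  using tanh_real_gt_neg1[of "c * s"] by (simp add: decay_def)

lemma decay_le_1: "0 \<le> c \<Longrightarrow> 0 \<le> s \<Longrightarrow> decay c s \<le> 1"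
  by (simp add: decay_def)

definition decay' :: "real \<Rightarrow> real \<Rightarrow> real" where
  "decay' c s = - c * (1 - tanh (c * s) ^ 2)"

lemma decay_deriv: "(decay c has_real_derivative decay' c s) (at s)"
  unfolding decay_def[abs_def] decay'_def by (auto intro!: derivative_eq_intros)

lemma decay'_le: "0 \<le> c \<Longrightarrow> 0 \<le> s \<Longrightarrow> decay' c s \<le> - c * decay c s"
proof -
  assume "0 \<le> c" "0 \<le> s"
  then have "0 \<le> tanh (c * s)" "tanh (c * s) \<le> 1" using tanh_real_lt_1[of "c * s"] by (auto simp: less_imp_le)
  then have "tanh (c * s) ^ 2 \<le> tanh (c * s)" by (simp add: power2_eq_square mult_left_le)
  then show ?thesis using \<open>0 \<le> c\<close> by (simp add: decay_def decay'_def mult_left_mono)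
qed

lemma abs_decay'_le: "\<bar>decay' c s\<bar> \<le> \<bar>c\<bar>"
proof -
  have "tanh (c * s) ^ 2 \<le> 1"
    using tanh_real_lt_1[of "c * s"] tanh_real_gt_neg1[of "c * s"] by (simp add: abs_square_le_1 abs_le_iff)
  then have "\<bar>1 - tanh (c * s) ^ 2\<bar> \<le> 1" by (simp add: abs_le_iff)
  then show ?thesis by (simp add: decay'_def abs_mult mult_left_le)
qed

lemma continuous_decay [continuous_intros]: "continuous_on A g \<Longrightarrow> continuous_on A (\<lambda>x. decay c (g x))"
  unfolding decay_def by (intro continuous_intros) auto

lemma continuous_decay' [continuous_intros]: "continuous_on A g \<Longrightarrow> continuous_on A (\<lambda>x. decay' c (g x))"
  unfolding decay'_def by (intro continuous_intros) auto

lemma measurable_decay [measurable]: "decay c \<in> borel_measurable borel"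
  by (intro borel_measurable_continuous_onI continuous_intros)

definition pair_decay :: "real \<Rightarrow> (nat \<Rightarrow> nat \<Rightarrow> real) \<times> (nat \<Rightarrow> 'a) \<Rightarrow> real" where
  "pair_decay c z = decay c (fst z 0 1)"

definition star_decay :: "real \<Rightarrow> (nat \<Rightarrow> nat \<Rightarrow> real) \<times> (nat \<Rightarrow> 'a) \<Rightarrow> real" where
  "star_decay c z = decay c (fst z 0 1) * decay c (fst z 0 2)"

lemma pderiv_pair_decay: "pderiv_dist (pair_decay c) 0 1 z = decay' c (fst z 0 1)"
  unfolding pderiv_dist_def pair_decay_def
  by (rule DERIV_imp_deriv) (simp add: upd_dist_def decay_deriv)

lemma pderiv_star_decay:
  "pderiv_dist (star_decay c) 0 1 z = decay' c (fst z 0 1) * decay c (fst z 0 2)"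
  "pderiv_dist (star_decay c) 0 2 z = decay c (fst z 0 1) * decay' c (fst z 0 2)"
  "pderiv_dist (star_decay c) 1 2 z = 0"
  unfolding pderiv_dist_def star_decay_def
  by (rule DERIV_imp_deriv; auto simp: upd_dist_def intro!: derivative_eq_intros decay_deriv)+

lemma continuous_entry [continuous_intros]:
  "continuous_on UNIV (\<lambda>rr :: nat \<Rightarrow> nat \<Rightarrow> real. rr i j)"
  by (rule continuous_on_product_then_coordinatewise[OF continuous_on_product_then_coordinatewise[OF
        continuous_on_id]])

lemma bounded_pair_decay: "\<bar>pair_decay c z\<bar> \<le> 2"
  using decay_pos[of c "fst z 0 1"] decay_less_2[of c "fst z 0 1"] by (simp add: pair_decay_def)

lemma bounded_star_decay: "\<bar>star_decay c z\<bar> \<le> 4"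
proof -
  have "\<bar>decay c s\<bar> \<le> 2" for s using decay_pos[of c s] decay_less_2[of c s] by linarith
  from mult_mono[OF this this, of "fst z 0 2" "fst z 0 1"] show ?thesis
    unfolding star_decay_def abs_mult by simp
qed

lemma test_fun_pair_decay: "test_fun 2 (pair_decay c :: _ \<times> (nat \<Rightarrow> 'a::topological_space) \<Rightarrow> real)"
proof -
  have "(pair_decay c :: _ \<times> (nat \<Rightarrow> 'a) \<Rightarrow> real) \<in> borel_measurable sample_space"
    unfolding pair_decay_def[abs_def] by measurable
  moreover have "bounded (range (pair_decay c :: _ \<times> (nat \<Rightarrow> 'a) \<Rightarrow> real))"
    using bounded_pair_decay by (auto simp: bounded_iff)
  moreover have "depends_first 2 (pair_decay c :: _ \<times> (nat \<Rightarrow> 'a) \<Rightarrow> real)"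
    by (simp add: depends_first_def pair_decay_def)
  moreover have "C1b_dist 2 (pair_decay c :: _ \<times> (nat \<Rightarrow> 'a) \<Rightarrow> real)"
    unfolding C1b_dist_def
  proof (intro allI impI)
    fix i j :: nat assume "i < j \<and> j < 2"
    then have ij: "i = 0" "j = 1" by auto
    have "(\<lambda>s. pair_decay c (upd_dist rr 0 1 s, aa)) field_differentiable at s" for rr and aa :: "nat \<Rightarrow> 'a" and s
      by (auto simp: pair_decay_def upd_dist_def field_differentiable_def intro!: decay_deriv exI)
    moreover have "bounded (range (pderiv_dist (pair_decay c :: _ \<times> (nat \<Rightarrow> 'a) \<Rightarrow> real) 0 1))"
      using abs_decay'_le by (auto simp: bounded_iff pderiv_pair_decay[unfolded One_nat_def])
    moreover have "continuous_on UNIV (\<lambda>rr. pderiv_dist (pair_decay c) 0 1 (rr, aa))" for aa :: "nat \<Rightarrow> 'a"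
      unfolding pderiv_pair_decay fst_conv by (intro continuous_intros)
    ultimately show "(\<forall>rr (aa :: nat \<Rightarrow> 'a) s. (\<lambda>s. pair_decay c (upd_dist rr i j s, aa)) field_differentiable at s) \<and>
           bounded (range (pderiv_dist (pair_decay c :: _ \<times> (nat \<Rightarrow> 'a) \<Rightarrow> real) i j)) \<and>
           (\<forall>aa :: nat \<Rightarrow> 'a. continuous_on UNIV (\<lambda>rr. pderiv_dist (pair_decay c) i j (rr, aa)))"
      unfolding ij by blast
  qed
  ultimately show ?thesis by (simp add: test_fun_def)
qed

lemma test_fun_star_decay: "test_fun 3 (star_decay c :: _ \<times> (nat \<Rightarrow> 'a::topological_space) \<Rightarrow> real)"
proof -
  have "(star_decay c :: _ \<times> (nat \<Rightarrow> 'a) \<Rightarrow> real) \<in> borel_measurable sample_space"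
    unfolding star_decay_def[abs_def] by measurable
  moreover have "bounded (range (star_decay c :: _ \<times> (nat \<Rightarrow> 'a) \<Rightarrow> real))"
    using bounded_star_decay by (auto simp: bounded_iff)
  moreover have "depends_first 3 (star_decay c :: _ \<times> (nat \<Rightarrow> 'a) \<Rightarrow> real)"
    by (simp add: depends_first_def star_decay_def)
  moreover have "C1b_dist 3 (star_decay c :: _ \<times> (nat \<Rightarrow> 'a) \<Rightarrow> real)"
    unfolding C1b_dist_def
  proof (intro allI impI)
    fix i j :: nat assume "i < j \<and> j < 3"
    then have ij: "(i = 0 \<and> j = 1) \<or> (i = 0 \<and> j = 2) \<or> (i = 1 \<and> j = 2)" by auto
    have "(\<lambda>s. star_decay c (upd_dist rr i j s, aa)) field_differentiable at s" for rr and aa :: "nat \<Rightarrow> 'a" and s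
      using ij unfolding field_differentiable_def star_decay_def upd_dist_def
      by (elim disjE) (auto intro!: exI derivative_eq_intros decay_deriv)
    moreover have "bounded (range (pderiv_dist (star_decay c :: _ \<times> (nat \<Rightarrow> 'a) \<Rightarrow> real) i j))"
    proof -
      have "\<bar>pderiv_dist (star_decay c) i j z\<bar> \<le> \<bar>c\<bar> * 2" for z :: "_ \<times> (nat \<Rightarrow> 'a)"
      proof -
        have b: "\<bar>decay' c s * decay c t\<bar> \<le> \<bar>c\<bar> * 2" for s t
          unfolding abs_mult using abs_decay'_le[of c s] decay_pos[of c t] decay_less_2[of c t]
          by (intro mult_mono) auto
        show ?thesis using ij by (elim disjE) (auto simp: pderiv_star_decay b mult.commute[of "decay c _"] simp flip: One_nat_def simp del: One_nat_def)
      qed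
      then show ?thesis by (auto simp: bounded_iff)
    qed
    moreover have "continuous_on UNIV (\<lambda>rr. pderiv_dist (star_decay c) i j (rr, aa))" for aa :: "nat \<Rightarrow> 'a"
      using ij by (elim disjE) (auto simp: pderiv_star_decay simp del: One_nat_def intro!: continuous_intros)
    ultimately show "(\<forall>rr (aa :: nat \<Rightarrow> 'a) s. (\<lambda>s. star_decay c (upd_dist rr i j s, aa)) field_differentiable at s) \<and>
           bounded (range (pderiv_dist (star_decay c :: _ \<times> (nat \<Rightarrow> 'a) \<Rightarrow> real) i j)) \<and>
           (\<forall>aa :: nat \<Rightarrow> 'a. continuous_on UNIV (\<lambda>rr. pderiv_dist (star_decay c) i j (rr, aa)))"
      by blast
  qed
  ultimately show ?thesis by (simp add: test_fun_def)
qed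

lemma cont_fun_star_decay: "cont_fun 3 (star_decay c :: _ \<times> (nat \<Rightarrow> 'a::topological_space) \<Rightarrow> real)"
proof -
  have e: "continuous_on UNIV (\<lambda>z :: (nat \<Rightarrow> nat \<Rightarrow> real) \<times> (nat \<Rightarrow> 'a). fst z i j)" for i j
    by (rule continuous_on_product_then_coordinatewise[OF continuous_on_product_then_coordinatewise[OF
        continuous_on_fst[OF continuous_on_id]]])
  have "continuous_on UNIV (star_decay c :: _ \<times> (nat \<Rightarrow> 'a) \<Rightarrow> real)"
    unfolding star_decay_def[abs_def] by (intro continuous_intros e)
  then show ?thesis using test_fun_star_decay[of c, where 'a='a] by (simp add: cont_fun_def bm_fun_def test_fun_def)
qed

lemma resample_entry:
  "fst (resample k l z) i j = (let sw = (\<lambda>i. if i = l then k else i) in if i \<noteq> j \<and> sw i = sw j then 0 else fst z (sw i) (sw j))"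
  by (simp add: resample_def Let_def)

lemma fitness_diff_le:
  assumes "fitness_fun fit" "0 \<le> (d::real)" "0 \<le> s" "0 \<le> s'"
  shows "d * fit a b s - d * fit a' b' s' \<le> d"
proof -
  have "fit a b s \<le> 1" "0 \<le> fit a' b' s'" using assms by (auto simp: fitness_fun_def)
  then have "d * fit a b s \<le> d" "0 \<le> d * fit a' b' s'" using assms(2) by (auto simp: mult_left_le)
  then show ?thesis by linarith
qed

lemma gen_density_pair_decay_le:
  assumes "fitness_fun fit" "0 \<le> \<alpha>" "0 \<le> c"
  shows "gen_density \<alpha> fit (pair_decay c) 2 z \<le> 1 - (c - 2 * \<alpha>) * pair_decay c (clean z)"
proof -
  let ?w = "clean z"
  define d where "d = decay c (fst ?w 0 1)"
  have d: "pair_decay c ?w = d" "0 \<le> d"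
    using decay_pos[of c "fst ?w 0 1"] by (auto simp: d_def pair_decay_def)
  have "(\<Sum>j<2. \<Sum>i<j. pderiv_dist (pair_decay c) i j ?w) = pderiv_dist (pair_decay c) 0 1 ?w"
    by (simp add: numeral_2_eq_2)
  also have "\<dots> \<le> - c * d"
    unfolding pderiv_pair_decay d_def by (intro decay'_le assms clean_dist_nonneg)
  finally have 1: "(\<Sum>j<2. \<Sum>i<j. pderiv_dist (pair_decay c) i j ?w) \<le> - c * d" .
  have r: "pair_decay c (resample 0 0 ?w) = d" "pair_decay c (resample 0 1 ?w) = 1"
    "pair_decay c (resample 1 0 ?w) = 1" "pair_decay c (resample 1 1 ?w) = d"
    by (simp_all add: pair_decay_def resample_entry d_def)
  have 2: "1/2 * (\<Sum>k<2. \<Sum>l<2. pair_decay c (resample k l ?w) - pair_decay c ?w) = 1 - d"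
    using r by (simp add: numeral_2_eq_2 d)
  have "(\<Sum>k<2. pair_decay c ?w * fit (snd z k) (snd z 2) (fst ?w k 2)
                 - pair_decay c ?w * fit (snd z 2) (snd z (Suc 2)) (fst ?w 2 (Suc 2))) \<le> (\<Sum>k<(2::nat). d)"
    unfolding d(1) by (intro sum_mono fitness_diff_le assms d clean_dist_nonneg)
  then have 3: "\<alpha> * (\<Sum>k<2. pair_decay c ?w * fit (snd z k) (snd z 2) (fst ?w k 2)
                 - pair_decay c ?w * fit (snd z 2) (snd z (Suc 2)) (fst ?w 2 (Suc 2))) \<le> \<alpha> * (2 * d)"
    using assms(2) by (intro mult_left_mono) auto
  show ?thesis using 1 2 3 d(2) unfolding gen_density_def d(1) by (simp add: algebra_simps)
qed

lemma gen_density_star_decay_le: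
  assumes "fitness_fun fit" "0 \<le> \<alpha>" "0 \<le> c"
  shows "gen_density \<alpha> fit (star_decay c) 3 z \<le> decay c (fst (clean z) 0 1)
    + decay c (fst (clean z) 0 2) + decay c (fst (clean z) 1 2) + 3 * \<alpha> * decay c (fst (clean z) 0 1)"
proof -
  let ?w = "clean z"
  define e where "e i j = decay c (fst ?w i j)" for i j
  define d where "d = e 0 1 * e 0 2"
  have e: "0 \<le> e i j" "e i j \<le> 1" for i j
    using decay_pos[of c "fst ?w i j"] decay_le_1[OF assms(3) clean_dist_nonneg[of z i j]] by (auto simp: e_def)
  have d: "star_decay c ?w = d" "0 \<le> d" "d \<le> e 0 1"
    using e by (auto simp: d_def e_def[symmetric] star_decay_def mult_left_le)
  have sums: "(\<Sum>j<3. f j) = f 0 + f 1 + f 2" for f :: "nat \<Rightarrow> real"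
    by (simp add: numeral_3_eq_3 numeral_2_eq_2)
  have neg: "decay' c (fst ?w i j) \<le> 0" for i j
    using decay'_le[OF assms(3) clean_dist_nonneg, of z i j] e(1)[of i j] assms(3)
    by (simp add: e_def) (meson mult_nonneg_nonneg neg_le_0_iff_le order_trans)
  have "(\<Sum>j<3. \<Sum>i<j. pderiv_dist (star_decay c) i j ?w) =
    pderiv_dist (star_decay c) 0 1 ?w + pderiv_dist (star_decay c) 0 2 ?w + pderiv_dist (star_decay c) 1 2 ?w"
    by (simp add: sums) (simp add: numeral_2_eq_2)
  also have "\<dots> \<le> 0"
    unfolding pderiv_star_decay e_def[symmetric] using neg e
    by (simp add: mult_nonpos_nonneg mult_nonneg_nonpos add_nonpos_nonpos)
  finally have 1: "(\<Sum>j<3. \<Sum>i<j. pderiv_dist (star_decay c) i j ?w) \<le> 0" .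
  have sym: "e 2 1 = e 1 2" unfolding e_def by (subst clean_dist_sym) (rule refl)
  have sq: "e i j * e i j \<le> e i j" for i j using e by (simp add: mult_left_le)
  have r: "star_decay c (resample 0 0 ?w) = d" "star_decay c (resample 1 1 ?w) = d" "star_decay c (resample 2 2 ?w) = d"
     "star_decay c (resample 0 1 ?w) = e 0 2" "star_decay c (resample 0 2 ?w) = e 0 1"
     "star_decay c (resample 1 0 ?w) = e 1 2" "star_decay c (resample 2 0 ?w) = e 2 1"
     "star_decay c (resample 1 2 ?w) = e 0 1 * e 0 1" "star_decay c (resample 2 1 ?w) = e 0 2 * e 0 2"
    by (simp_all add: star_decay_def resample_entry d_def e_def)
  have 2: "1/2 * (\<Sum>k<3. \<Sum>l<3. star_decay c (resample k l ?w) - star_decay c ?w) \<le> e 0 1 + e 0 2 + e 1 2"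
    unfolding sums r d(1) using sq[of 0 1] sq[of 0 2] sym d(2) by simp
  have "(\<Sum>k<3. star_decay c ?w * fit (snd z k) (snd z 3) (fst ?w k 3)
                 - star_decay c ?w * fit (snd z 3) (snd z (Suc 3)) (fst ?w 3 (Suc 3))) \<le> (\<Sum>k<(3::nat). e 0 1)"
    unfolding d(1) using d(3)
    by (intro sum_mono order_trans[OF fitness_diff_le[OF assms(1) d(2) clean_dist_nonneg clean_dist_nonneg]])
  then have 3: "\<alpha> * (\<Sum>k<3. star_decay c ?w * fit (snd z k) (snd z 3) (fst ?w k 3)
                 - star_decay c ?w * fit (snd z 3) (snd z (Suc 3)) (fst ?w 3 (Suc 3))) \<le> \<alpha> * (3 * e 0 1)"
    using assms(2) by (intro mult_left_mono) auto
  show ?thesis using 1 2 3 unfolding gen_density_def d(1) e_def by (simp add: algebra_simps)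
qed

lemma bounded_borel_pair_decay: "bounded_borel (sample_space :: (_ \<times> (nat \<Rightarrow> 'a::topological_space)) measure) (pair_decay c)"
  using test_fun_pair_decay[of c, where 'a='a] by (simp add: bounded_borel_iff test_fun_def)

lemma bounded_borel_star_decay: "bounded_borel (sample_space :: (_ \<times> (nat \<Rightarrow> 'a::topological_space)) measure) (star_decay c)"
  using test_fun_star_decay[of c, where 'a='a] by (simp add: bounded_borel_iff test_fun_def)

lemma bounded_borel_decay_entry: "bounded_borel sample_space (\<lambda>z. decay c (fst z i j))"
proof (rule bounded_borelI[where K=2])
  show "\<bar>decay c (fst z i j)\<bar> \<le> 2" for z :: "_ \<times> (nat \<Rightarrow> 'a)"
    using decay_pos[of c "fst z i j"] decay_less_2[of c "fst z i j"] by linarith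
qed measurable

context
  fixes X :: "('u \<Rightarrow> 'u \<Rightarrow> real) \<times> ('u \<times> 'a::metric_space) measure"
  assumes X: "mmm_space (fst X) (snd X)"
begin

lemma Phi_gen_density_pair_le:
  assumes "compact (UNIV :: 'a set)" "fitness_fun fit" "0 \<le> \<alpha>" "0 \<le> c"
  shows "Phi (gen_density \<alpha> fit (pair_decay c) 2) X \<le> Phi (\<lambda>z. 1 - (c - 2 * \<alpha>) * pair_decay c z) X"
proof (rule Phi_mono[OF X bounded_borel_gen_density[OF assms(1,2) test_fun_pair_decay]])
  show "bounded_borel sample_space (\<lambda>z. 1 - (c - 2 * \<alpha>) * pair_decay c z)"
    by (intro bounded_borel_diff bounded_borel_mult bounded_borel_const bounded_borel_pair_decay)
qed (use gen_density_pair_decay_le[OF assms(2-4), of "clean _"] in simp)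

lemma Phi_gen_density_star_le:
  assumes "compact (UNIV :: 'a set)" "fitness_fun fit" "0 \<le> \<alpha>" "0 \<le> c"
  shows "Phi (gen_density \<alpha> fit (star_decay c) 3) X \<le> (3 + 3 * \<alpha>) * Phi (pair_decay c) X"
proof -
  note b = bounded_borel_decay_entry[of c]
  have "Phi (gen_density \<alpha> fit (star_decay c) 3) X \<le> Phi (\<lambda>z. decay c (fst z 0 1)
    + decay c (fst z 0 2) + decay c (fst z 1 2) + 3 * \<alpha> * decay c (fst z 0 1)) X"
  proof (rule Phi_mono[OF X bounded_borel_gen_density[OF assms(1,2) test_fun_star_decay]])
    show "bounded_borel sample_space (\<lambda>z :: _ \<times> (nat \<Rightarrow> 'a). decay c (fst z 0 1)
      + decay c (fst z 0 2) + decay c (fst z 1 2) + 3 * \<alpha> * decay c (fst z 0 1))"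
      by (intro bounded_borel_add bounded_borel_mult bounded_borel_const b)
  qed (use gen_density_star_decay_le[OF assms(2-4), of "clean _"] in simp)
  also have "\<dots> = Phi (\<lambda>z. decay c (fst z 0 1)) X + Phi (\<lambda>z. decay c (fst z 0 2)) X + Phi (\<lambda>z. decay c (fst z 1 2)) X
      + 3 * \<alpha> * Phi (\<lambda>z. decay c (fst z 0 1)) X"
    by (simp only: Phi_add[OF X] Phi_cmult[OF X] b bounded_borel_add bounded_borel_mult bounded_borel_const)
  also have "\<dots> = (3 + 3 * \<alpha>) * Phi (pair_decay c) X"
    using Phi_pair_exchange[OF X, of 0 2 "decay c"] Phi_pair_exchange[OF X, of 1 2 "decay c"]
    by (simp add: pair_decay_def[abs_def] algebra_simps)
  finally show ?thesis .
qed

lemma Phi_pair_decay_bounds: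
  assumes "0 \<le> c" shows "0 \<le> Phi (pair_decay c) X" "Phi (pair_decay c) X \<le> 1"
proof -
  have "0 \<le> pair_decay c (clean z)" "pair_decay c (clean z) \<le> 1" for z :: "_ \<times> (nat \<Rightarrow> 'a)"
    using decay_pos[of c "fst (clean z) 0 1"] decay_le_1[OF assms clean_dist_nonneg[of z 0 1]]
    by (auto simp: pair_decay_def)
  then show "0 \<le> Phi (pair_decay c) X" "Phi (pair_decay c) X \<le> 1"
    using Phi_mono[OF X bounded_borel_pair_decay bounded_borel_const, of c 1]
      Phi_mono[OF X bounded_borel_const bounded_borel_pair_decay, of 0 c]
    by (simp_all add: Phi_const[OF X])
qed

lemma Phi_star_decay_bounds:
  assumes "0 \<le> c" shows "0 \<le> Phi (star_decay c) X" "Phi (star_decay c) X \<le> Phi (pair_decay c) X"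
proof -
  have "0 \<le> star_decay c (clean z)" "star_decay c (clean z) \<le> pair_decay c (clean z)" for z :: "_ \<times> (nat \<Rightarrow> 'a)"
    using decay_pos[of c "fst (clean z) 0 1"] decay_pos[of c "fst (clean z) 0 2"] decay_le_1[OF assms clean_dist_nonneg[of z 0 2]]
    by (auto simp: pair_decay_def star_decay_def mult_left_le)
  then show "0 \<le> Phi (star_decay c) X" "Phi (star_decay c) X \<le> Phi (pair_decay c) X"
    using Phi_mono[OF X bounded_borel_star_decay bounded_borel_pair_decay, of c c]
      Phi_mono[OF X bounded_borel_const bounded_borel_star_decay, of 0 c]
    by (simp_all add: Phi_const[OF X])
qed

lemma no_atoms_if_star_null:
  assumes "emeasure (PiM UNIV (\<lambda>_::nat. snd X)) {x \<in> space (PiM UNIV (\<lambda>_::nat. snd X)).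
     fst X (fst (x 0)) (fst (x 1)) = 0 \<and> fst X (fst (x 0)) (fst (x 2)) = 0} = 0"
  shows "no_atoms X"
proof -
  interpret \<mu>: prob_space "snd X" using X by (simp add: mmm_space_def)
  interpret product_prob_space "\<lambda>_. snd X" "UNIV :: nat set" ..
  interpret sequence_space "snd X" ..
  let ?r = "\<lambda>x y. fst X (fst x) (fst y)"
  let ?A = "{x \<in> space S. ?r (x 0) (x 1) = 0 \<and> ?r (x 0) (x 2) = 0}"
  let ?c = "\<lambda>(s, \<omega>). case_nat s \<omega>"
  define D where "D = {p \<in> space (snd X \<Otimes>\<^sub>M snd X). ?r (fst p) (snd p) = 0}"
  have r: "(\<lambda>p. ?r (fst p) (snd p)) \<in> borel_measurable (snd X \<Otimes>\<^sub>M snd X)"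
    using X unfolding mmm_space_def case_prod_beta by blast
  then have D [measurable]: "D \<in> sets (snd X \<Otimes>\<^sub>M snd X)" unfolding D_def by measurable
  have [measurable]: "(\<lambda>x. ?r (x i) (x j)) \<in> borel_measurable S" for i j
    using measurable_compose[OF _ r, of "\<lambda>x. (x i, x j)" S] by simp
  have A: "?A \<in> sets S" by measurable
  have c: "?c \<in> snd X \<Otimes>\<^sub>M S \<rightarrow>\<^sub>M S" by measurable
  have "0 = emeasure (distr (snd X \<Otimes>\<^sub>M S) S ?c) ?A"
    unfolding PiM_iter using assms by simp
  also have "\<dots> = emeasure (snd X \<Otimes>\<^sub>M S) (?c -` ?A \<inter> space (snd X \<Otimes>\<^sub>M S))"
    by (rule emeasure_distr[OF c A])
  also have "\<dots> = (\<integral>\<^sup>+x. emeasure S (Pair x -` (?c -` ?A \<inter> space (snd X \<Otimes>\<^sub>M S))) \<partial>snd X)"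
    by (rule P.emeasure_pair_measure_alt[OF measurable_sets[OF c A]])
  also have "\<dots> = (\<integral>\<^sup>+x. emeasure (snd X) (Pair x -` D) ^ 2 \<partial>snd X)"
  proof (rule nn_integral_cong)
    fix x assume x: "x \<in> space (snd X)"
    have "Pair x -` (?c -` ?A \<inter> space (snd X \<Otimes>\<^sub>M S)) = {\<omega> \<in> space S. \<forall>i\<in>{0, 1}. \<omega> i \<in> Pair x -` D}"
    proof -
      have "case_nat x \<omega> \<in> space S" if "\<omega> \<in> space S" for \<omega>
        using that x by (auto simp: space_PiM PiE_iff split: nat.split)
      moreover have "\<omega> i \<in> space (snd X)" if "\<omega> \<in> space S" for \<omega> i
        using that by (auto simp: space_PiM PiE_iff)
      ultimately show ?thesis
        using x by (auto simp: D_def space_pair_measure numeral_2_eq_2)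
    qed
    also have "emeasure S \<dots> = (\<Prod>i\<in>{0, 1::nat}. emeasure (snd X) (Pair x -` D))"
      by (rule emeasure_PiM_Collect) (auto intro: sets_Pair1[OF D])
    finally show "emeasure S (Pair x -` (?c -` ?A \<inter> space (snd X \<Otimes>\<^sub>M S))) = emeasure (snd X) (Pair x -` D) ^ 2"
      by (simp add: power2_eq_square)
  qed
  finally have "AE x in snd X. emeasure (snd X) (Pair x -` D) ^ 2 = 0"
    using \<mu>.measurable_emeasure_Pair[OF D] by (subst (asm) eq_commute, subst (asm) nn_integral_0_iff_AE) auto
  then have "AE x in snd X. emeasure (snd X) (Pair x -` D) = 0"
    by (rule AE_mp) simp
  then have "(\<integral>\<^sup>+x. emeasure (snd X) (Pair x -` D) \<partial>snd X) = 0"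
    using \<mu>.measurable_emeasure_Pair[OF D] by (subst nn_integral_0_iff_AE) auto
  then have "emeasure (snd X \<Otimes>\<^sub>M snd X) D = 0"
    by (simp add: \<mu>.emeasure_pair_measure_alt[OF D])
  then show ?thesis by (simp add: no_atoms_def D_def measure_def)
qed

lemma no_atoms_if_star_decay_small:
  assumes "\<And>\<delta>. 0 < \<delta> \<Longrightarrow> \<exists>c\<ge>0. Phi (star_decay c) X \<le> \<delta>"
  shows "no_atoms X"
proof -
  let ?S = "PiM UNIV (\<lambda>_::nat. snd X)"
  interpret prob_space ?S by (rule prob_space_sampling[OF X])
  let ?A = "{x \<in> space ?S. fst X (fst (x 0)) (fst (x 1)) = 0 \<and> fst X (fst (x 0)) (fst (x 2)) = 0}"
  have [measurable]: "(\<lambda>x. fst X (fst (x i)) (fst (x j))) \<in> borel_measurable ?S" for i j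
    using measurable_compose[OF measurable_sample[OF X] measurable_dist_entry] by (simp add: sample_def)
  have A: "?A \<in> sets ?S" by measurable
  have le: "measure ?S ?A \<le> Phi (star_decay c) X" if "0 \<le> c" for c
  proof -
    have "measure ?S ?A = (\<integral>x. indicator ?A x \<partial>?S)" using A by simp
    also have "\<dots> \<le> (\<integral>x. star_decay c (sample (fst X) x) \<partial>?S)"
    proof (rule integral_mono[OF _ integrable_sample[OF X bounded_borel_star_decay]])
      show "indicator ?A x \<le> star_decay c (sample (fst X) x)" for x
        using decay_pos[of c] by (auto simp: star_decay_def sample_def indicator_def less_imp_le)
    qed (use A in \<open>simp add: integrable_indicator_iff emeasure_eq_measure\<close>)
    finally show ?thesis by (simp add: Phi_def)
  qed
  have "measure ?S ?A \<le> \<delta>" if "0 < \<delta>" for \<delta>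
    using assms[OF that] le by (meson order_trans)
  from this[of "measure ?S ?A / 2"] have "measure ?S ?A \<le> 0" by linarith
  then have "emeasure ?S ?A = 0" by (simp add: emeasure_eq_measure measure_le_0_iff)
  then show ?thesis by (rule no_atoms_if_star_null)
qed

end

section \<open>Maximal inequality and drift estimates\<close>

lemma maximal_inequality_finite:
  fixes V :: "real \<Rightarrow> 'w \<Rightarrow> real" and F :: "real \<Rightarrow> 'w set set" and J :: "real \<Rightarrow> real"
  assumes "prob_space M" and "0 \<le> \<delta>"
    and F: "\<And>t B. 0 \<le> t \<Longrightarrow> B \<in> F t \<Longrightarrow> B \<in> sets M" "\<And>s t B. 0 \<le> s \<Longrightarrow> s \<le> t \<Longrightarrow> B \<in> F s \<Longrightarrow> B \<in> F t"
    and F_level: "\<And>t B. 0 \<le> t \<Longrightarrow> B \<in> F t \<Longrightarrow> B \<inter> {\<omega>\<in>space M. V t \<omega> < \<delta>} \<in> F t"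
    and V: "\<And>t. 0 \<le> t \<Longrightarrow> V t \<in> borel_measurable M" "\<And>t \<omega>. 0 \<le> t \<Longrightarrow> \<omega> \<in> space M \<Longrightarrow> 0 \<le> V t \<omega>"
      "\<And>t \<omega>. 0 \<le> t \<Longrightarrow> \<omega> \<in> space M \<Longrightarrow> V t \<omega> \<le> K"
    and drift: "\<And>s t B. 0 \<le> s \<Longrightarrow> s \<le> t \<Longrightarrow> B \<in> F s \<Longrightarrow>
      (\<integral>\<omega>. indicator B \<omega> * V t \<omega> \<partial>M) \<le> (\<integral>\<omega>. indicator B \<omega> * V s \<omega> \<partial>M) + (J t - J s)"
    and J: "\<And>s t. 0 \<le> s \<Longrightarrow> s \<le> t \<Longrightarrow> J s \<le> J t"
  shows "sorted (s # ts) \<Longrightarrow> 0 \<le> s \<Longrightarrow> s \<le> T \<Longrightarrow> (\<And>t. t \<in> set ts \<Longrightarrow> t \<le> T) \<Longrightarrow> B \<in> F s \<Longrightarrow>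
    \<delta> * measure M (B \<inter> {\<omega>\<in>space M. \<exists>t\<in>set ts. \<delta> \<le> V t \<omega>}) \<le> (\<integral>\<omega>. indicator B \<omega> * V s \<omega> \<partial>M) + (J T - J s)"
proof (induction ts arbitrary: s B)
  case Nil
  have "0 \<le> (\<integral>\<omega>. indicator B \<omega> * V s \<omega> \<partial>M)"
    using Nil V by (intro Bochner_Integration.integral_nonneg_AE) (auto intro!: AE_I2)
  then show ?case using J[of s T] Nil by simp
next
  case (Cons t ts)
  interpret prob_space M by fact
  have t: "0 \<le> t" "s \<le> t" "t \<le> T" using Cons.prems by auto
  have pos: "\<And>u. u \<in> set ts \<Longrightarrow> 0 \<le> u" using Cons.prems t by fastforce
  have level: "{\<omega>\<in>space M. \<delta> \<le> V u \<omega>} \<in> events" "{\<omega>\<in>space M. V u \<omega> < \<delta>} \<in> events" if "0 \<le> u" for u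
    using V(1)[OF that] by simp_all
  note [measurable] = V(1)[OF t(1)] level[OF t(1)]
  let ?B = "B \<inter> {\<omega>\<in>space M. V t \<omega> < \<delta>}" and ?C = "B \<inter> {\<omega>\<in>space M. \<delta> \<le> V t \<omega>}"
  let ?E = "{\<omega>\<in>space M. \<exists>u\<in>set ts. \<delta> \<le> V u \<omega>}"
  have Bt: "B \<in> F t" using F(2) Cons.prems t by blast
  have [measurable]: "B \<in> sets M" using F(1) t Bt by blast
  have [measurable]: "?E \<in> sets M"
  proof -
    have "?E = (\<Union>u\<in>set ts. {\<omega>\<in>space M. \<delta> \<le> V u \<omega>})" by auto
    then show ?thesis using level(1)[OF pos] by auto
  qed
  have int: "integrable M (\<lambda>\<omega>. indicator A \<omega> * V t \<omega>)" if [measurable]: "A \<in> sets M" for A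
  proof (rule integrable_const_bound[where B="max 0 K"])
    show "AE \<omega> in M. norm (indicator A \<omega> * V t \<omega>) \<le> max 0 K"
    proof (rule AE_I2)
      fix \<omega> assume "\<omega> \<in> space M"
      then have "0 \<le> V t \<omega>" "V t \<omega> \<le> K" using V(2,3) t(1) by blast+
      then show "norm (indicator A \<omega> * V t \<omega>) \<le> max 0 K" by (simp add: indicator_def)
    qed
  qed measurable
  have IH: "\<delta> * measure M (?B \<inter> ?E) \<le> (\<integral>\<omega>. indicator ?B \<omega> * V t \<omega> \<partial>M) + (J T - J t)"
    using Cons.prems t Bt F_level by (intro Cons.IH) auto
  have "B \<inter> {\<omega>\<in>space M. \<exists>u\<in>set (t # ts). \<delta> \<le> V u \<omega>} = ?C \<union> (?B \<inter> ?E)"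
    by auto
  then have "measure M (B \<inter> {\<omega>\<in>space M. \<exists>u\<in>set (t # ts). \<delta> \<le> V u \<omega>}) \<le> measure M ?C + measure M (?B \<inter> ?E)"
    by (simp add: measure_Un_le)
  from mult_left_mono[OF this \<open>0 \<le> \<delta>\<close>]
  have "\<delta> * measure M (B \<inter> {\<omega>\<in>space M. \<exists>u\<in>set (t # ts). \<delta> \<le> V u \<omega>}) \<le> \<delta> * measure M ?C + \<delta> * measure M (?B \<inter> ?E)"
    by (simp only: distrib_left)
  moreover have "\<delta> * measure M ?C \<le> (\<integral>\<omega>. indicator ?C \<omega> * V t \<omega> \<partial>M)"
  proof -
    have "\<delta> * measure M ?C = (\<integral>\<omega>. \<delta> * indicator ?C \<omega> \<partial>M)" by simp
    also have "\<dots> \<le> (\<integral>\<omega>. indicator ?C \<omega> * V t \<omega> \<partial>M)"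
    proof (intro integral_mono int)
      show "integrable M (\<lambda>\<omega>. \<delta> * indicator ?C \<omega>)"
        by (intro integrable_mult_right integrable_real_indicator) (simp_all add: emeasure_eq_measure)
    qed (auto simp: indicator_def)
    finally show ?thesis .
  qed
  moreover have "(\<integral>\<omega>. indicator ?C \<omega> * V t \<omega> \<partial>M) + (\<integral>\<omega>. indicator ?B \<omega> * V t \<omega> \<partial>M) = (\<integral>\<omega>. indicator B \<omega> * V t \<omega> \<partial>M)"
  proof -
    have "(\<integral>\<omega>. indicator ?C \<omega> * V t \<omega> \<partial>M) + (\<integral>\<omega>. indicator ?B \<omega> * V t \<omega> \<partial>M) =
      (\<integral>\<omega>. indicator ?C \<omega> * V t \<omega> + indicator ?B \<omega> * V t \<omega> \<partial>M)"
      by (intro Bochner_Integration.integral_add[symmetric] int) auto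
    also have "\<dots> = (\<integral>\<omega>. indicator B \<omega> * V t \<omega> \<partial>M)"
      by (intro Bochner_Integration.integral_cong) (auto simp: indicator_def)
    finally show ?thesis .
  qed
  ultimately show ?case using IH drift[OF \<open>0 \<le> s\<close> t(2) \<open>B \<in> F s\<close>] by linarith
qed

lemma (in prob_space) set_integral_expectation_swap:
  fixes g :: "real \<Rightarrow> 'a \<Rightarrow> real"
  assumes [measurable]: "case_prod g \<in> borel_measurable (lborel \<Otimes>\<^sub>M M)"
    and bound: "\<And>\<tau> \<omega>. \<omega> \<in> space M \<Longrightarrow> \<bar>g \<tau> \<omega>\<bar> \<le> K" and [measurable]: "B \<in> events"
  shows "integrable M (\<lambda>\<omega>. indicator B \<omega> * (LINT \<tau>:{a..b}|lborel. g \<tau> \<omega>))" (is ?int)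
    and "set_integrable lborel {a..b} (\<lambda>\<tau>. \<integral>\<omega>. indicator B \<omega> * g \<tau> \<omega> \<partial>M)" (is ?sint)
    and "(\<integral>\<omega>. indicator B \<omega> * (LINT \<tau>:{a..b}|lborel. g \<tau> \<omega>) \<partial>M) =
      (LINT \<tau>:{a..b}|lborel. \<integral>\<omega>. indicator B \<omega> * g \<tau> \<omega> \<partial>M)" (is ?eq)
proof -
  note times = emeasure_pair_measure_Times
  interpret pair_sigma_finite lborel M ..
  let ?h = "\<lambda>\<tau> \<omega>. indicator {a..b} \<tau> * (indicator B \<omega> * g \<tau> \<omega>)"
  have h: "integrable (lborel \<Otimes>\<^sub>M M) (case_prod ?h)"
  proof (rule integrableI_bounded_set)
    show "case_prod ?h \<in> borel_measurable (lborel \<Otimes>\<^sub>M M)" by measurable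
    show "{a..b} \<times> space M \<in> sets (lborel \<Otimes>\<^sub>M M)" by (intro pair_measureI) auto
    show "emeasure (lborel \<Otimes>\<^sub>M M) ({a..b} \<times> space M) < \<infinity>"
      by (subst times) (auto simp: emeasure_space_1 emeasure_lborel_Icc_eq)
    show "AE x in lborel \<Otimes>\<^sub>M M. x \<in> {a..b} \<times> space M \<longrightarrow> norm (case_prod ?h x) \<le> \<bar>K\<bar>"
      using order_trans[OF bound abs_ge_self] by (auto simp: indicator_def intro!: AE_I2)
    show "AE x in lborel \<Otimes>\<^sub>M M. x \<notin> {a..b} \<times> space M \<longrightarrow> case_prod ?h x = 0"
      by (auto simp: indicator_def space_pair_measure intro!: AE_I2)
  qed
  have e: "(\<integral>\<tau>. ?h \<tau> \<omega> \<partial>lborel) = indicator B \<omega> * (LINT \<tau>:{a..b}|lborel. g \<tau> \<omega>)" for \<omega>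
    unfolding set_lebesgue_integral_def
    by (subst integral_mult_right_zero[symmetric], rule Bochner_Integration.integral_cong) auto
  have e': "(\<integral>\<omega>. ?h \<tau> \<omega> \<partial>M) = indicator {a..b} \<tau> * (\<integral>\<omega>. indicator B \<omega> * g \<tau> \<omega> \<partial>M)" for \<tau>
    by simp
  show ?int using integrable_snd[OF h] by (simp only: e)
  show ?sint using integrable_fst[OF h] by (simp only: set_integrable_def e' real_scaleR_def)
  show ?eq using Fubini_integral[OF h] by (simp only: set_lebesgue_integral_def[of lborel "{a..b}" "\<lambda>\<tau>. \<integral>\<omega>. indicator B \<omega> * g \<tau> \<omega> \<partial>M"] e e' real_scaleR_def)
qed

locale tree_valued_FV =
  fixes M :: "'w measure"
    and X :: "real \<Rightarrow> 'w \<Rightarrow> ('u \<Rightarrow> 'u \<Rightarrow> real) \<times> ('u \<times> 'a::metric_space) measure"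
    and \<theta> \<alpha> :: real
    and \<beta> :: "'a \<Rightarrow> 'a measure"
    and fit :: "'a \<Rightarrow> 'a \<Rightarrow> real \<Rightarrow> real"
  assumes compact: "compact (UNIV :: 'a set)"
    and \<beta>: "\<beta> \<in> borel \<rightarrow>\<^sub>M prob_algebra borel"
    and \<alpha>: "\<alpha> \<ge> 0"
    and fit: "fitness_fun fit"
    and sol: "TFV_solution M \<theta> \<beta> \<alpha> fit X"
begin

sublocale prob_space M using sol by (simp add: TFV_solution_def)

lemma mmm: "0 \<le> t \<Longrightarrow> \<omega> \<in> space M \<Longrightarrow> mmm_space (fst (X t \<omega>)) (snd (X t \<omega>))"
  using sol by (simp add: TFV_solution_def)

lemma Phi_measurable: "bm_fun n \<psi> \<Longrightarrow> 0 \<le> t \<Longrightarrow> (\<lambda>\<omega>. Phi \<psi> (X t \<omega>)) \<in> borel_measurable M"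
  using sol unfolding TFV_solution_def by blast

lemma Phi_jointly_measurable:
  assumes "bm_fun n \<psi>"
  shows "(\<lambda>(\<tau>, \<omega>). Phi \<psi> (X (max 0 \<tau>) \<omega>)) \<in> borel_measurable (lborel \<Otimes>\<^sub>M M)"
proof -
  have 1: "(\<lambda>(t, \<omega>). Phi \<psi> (X t \<omega>)) \<in> borel_measurable (restrict_space lborel {0..} \<Otimes>\<^sub>M M)"
    using sol assms unfolding TFV_solution_def by blast
  have "(\<lambda>\<tau>. max 0 \<tau>) \<in> lborel \<rightarrow>\<^sub>M restrict_space lborel {0::real..}"
    by (intro measurable_restrict_space2) auto
  then have "(\<lambda>p. (max 0 (fst p), snd p)) \<in> lborel \<Otimes>\<^sub>M M \<rightarrow>\<^sub>M restrict_space lborel {0::real..} \<Otimes>\<^sub>M M"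
    by (intro measurable_Pair measurable_snd measurable_compose[OF measurable_fst])
  from measurable_compose[OF this 1] show ?thesis by (simp add: case_prod_beta)
qed

lemma Phi_bounded:
  assumes "bm_fun n \<psi>"
  obtains K where "\<And>t \<omega>. 0 \<le> t \<Longrightarrow> \<omega> \<in> space M \<Longrightarrow> \<bar>Phi \<psi> (X t \<omega>)\<bar> \<le> K"
proof -
  have b: "bounded_borel sample_space \<psi>" using assms by (simp add: bm_fun_def bounded_borel_iff)
  then obtain K where "\<And>z. \<bar>\<psi> z\<bar> \<le> K" by (auto simp: bounded_borel_def)
  then show thesis using that[of K] Phi_abs_le[OF mmm b] by blast
qed

lemma integrable_Phi:
  assumes "bm_fun n \<psi>" "0 \<le> t" and [measurable]: "B \<in> events"
  shows "integrable M (\<lambda>\<omega>. indicator B \<omega> * Phi \<psi> (X t \<omega>))"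
proof -
  obtain K where K: "\<And>t \<omega>. 0 \<le> t \<Longrightarrow> \<omega> \<in> space M \<Longrightarrow> \<bar>Phi \<psi> (X t \<omega>)\<bar> \<le> K"
    using Phi_bounded[OF assms(1)] by blast
  have [measurable]: "(\<lambda>\<omega>. Phi \<psi> (X t \<omega>)) \<in> borel_measurable M" using Phi_measurable assms by blast
  show ?thesis using K[OF assms(2)]
    by (intro integrable_const_bound[where B="\<bar>K\<bar>"] AE_I2)
      (auto simp: indicator_def intro: order_trans[OF _ abs_ge_self])
qed

lemma sets_nat_filtration:
  "sets (nat_filtration M X s) = sigma_sets (space M) {f -` C \<inter> space M | f C.
        (\<exists>u n \<psi>. 0 \<le> u \<and> u \<le> s \<and> test_fun n \<psi> \<and> f = (\<lambda>\<omega>. Phi \<psi> (X u \<omega>))) \<and> C \<in> sets borel}"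
  unfolding nat_filtration_def by (rule sets_measure_of) auto

lemma nat_filtration_mono: "s \<le> t \<Longrightarrow> sets (nat_filtration M X s) \<subseteq> sets (nat_filtration M X t)"
  unfolding sets_nat_filtration by (intro sigma_sets_mono') (blast intro: order_trans)

lemma nat_filtration_subset: "sets (nat_filtration M X s) \<subseteq> events"
  unfolding sets_nat_filtration
proof (rule sets.sigma_sets_subset, clarify)
  fix u :: real and n and \<psi> :: "(nat \<Rightarrow> nat \<Rightarrow> real) \<times> (nat \<Rightarrow> 'a) \<Rightarrow> real" and C :: "real set"
  assume "0 \<le> u" "test_fun n \<psi>" "C \<in> sets borel"
  then show "(\<lambda>\<omega>. Phi \<psi> (X u \<omega>)) -` C \<inter> space M \<in> events"
    using Phi_measurable[of n \<psi> u] by (auto simp: test_fun_def bm_fun_def intro: measurable_sets)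
qed

lemma space_in_nat_filtration: "space M \<in> sets (nat_filtration M X s)"
  unfolding sets_nat_filtration by (rule sigma_sets_top)

lemma level_in_nat_filtration:
  assumes "0 \<le> t" "test_fun n \<psi>" "B \<in> sets (nat_filtration M X t)"
  shows "B \<inter> {\<omega>\<in>space M. Phi \<psi> (X t \<omega>) < \<delta>} \<in> sets (nat_filtration M X t)"
proof -
  have "(\<lambda>\<omega>. Phi \<psi> (X t \<omega>)) -` {..<\<delta>} \<inter> space M \<in> sets (nat_filtration M X t)"
    unfolding sets_nat_filtration using assms(1,2)
    by (intro sigma_sets.Basic CollectI exI[of _ "\<lambda>\<omega>. Phi \<psi> (X t \<omega>)"] exI[of _ "{..<\<delta>}"] conjI refl
        exI[of _ t] exI[of _ n] exI[of _ \<psi>]) auto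
  then have "{\<omega>\<in>space M. Phi \<psi> (X t \<omega>) < \<delta>} \<in> sets (nat_filtration M X t)"
    by (simp add: vimage_def Int_def conj_commute)
  then show ?thesis using assms(3) by (intro sets.Int)
qed

lemma expectation_drift_le:
  assumes \<phi>: "test_fun n \<phi>" and markfree: "\<And>k b z. \<phi> (mutate k b z) = \<phi> z" and h: "bm_fun m h"
    and le: "\<And>t \<omega>. 0 \<le> t \<Longrightarrow> \<omega> \<in> space M \<Longrightarrow> Phi (gen_density \<alpha> fit \<phi> n) (X t \<omega>) \<le> Phi h (X t \<omega>)"
    and st: "0 \<le> s" "s \<le> t" and B: "B \<in> sets (nat_filtration M X s)"
  shows "(\<integral>\<omega>. indicator B \<omega> * Phi \<phi> (X t \<omega>) \<partial>M) \<le> (\<integral>\<omega>. indicator B \<omega> * Phi \<phi> (X s \<omega>) \<partial>M)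
    + (LINT \<tau>:{s<..t}|lborel. \<integral>\<omega>. indicator B \<omega> * Phi h (X (max 0 \<tau>) \<omega>) \<partial>M)"
proof -
  let ?g = "gen_density \<alpha> fit \<phi> n"
  let ?I = "\<lambda>t \<omega>. LINT \<tau>:{0..t}|lborel. generator \<theta> \<beta> \<alpha> fit \<phi> n (X \<tau> \<omega>)"
  let ?I' = "\<lambda>t \<omega>. LINT \<tau>:{0..t}|lborel. Phi ?g (X (max 0 \<tau>) \<omega>)"
  let ?u = "\<lambda>\<psi> \<tau>. \<integral>\<omega>. indicator B \<omega> * Phi \<psi> (X (max 0 \<tau>) \<omega>) \<partial>M"
  note g = bm_fun_gen_density[OF compact fit \<phi>, of \<alpha>]
  have BM [measurable]: "B \<in> events" using B nat_filtration_subset by blast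
  have \<phi>': "bm_fun n \<phi>" using \<phi> by (simp add: test_fun_def bm_fun_def)
  have I: "?I t \<omega> = ?I' t \<omega>" if "\<omega> \<in> space M" for t \<omega>
    using that by (intro set_lebesgue_integral_cong)
      (auto simp: max_absorb2 generator_eq_Phi[OF compact fit \<phi> mmm \<beta> markfree])
  obtain K where K: "\<And>t \<omega>. 0 \<le> t \<Longrightarrow> \<omega> \<in> space M \<Longrightarrow> \<bar>Phi ?g (X t \<omega>)\<bar> \<le> K"
    using Phi_bounded[OF g] by blast
  obtain L where L: "\<And>t \<omega>. 0 \<le> t \<Longrightarrow> \<omega> \<in> space M \<Longrightarrow> \<bar>Phi h (X t \<omega>)\<bar> \<le> L"
    using Phi_bounded[OF h] by blast
  have K': "\<bar>Phi ?g (X (max 0 \<tau>) \<omega>)\<bar> \<le> K" if "\<omega> \<in> space M" for \<tau> \<omega> using K that by simp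
  have L': "\<bar>Phi h (X (max 0 \<tau>) \<omega>)\<bar> \<le> L" if "\<omega> \<in> space M" for \<tau> \<omega> using L that by simp
  note swap_g = set_integral_expectation_swap[OF Phi_jointly_measurable[OF g] K' BM]
  note swap_h = set_integral_expectation_swap[OF Phi_jointly_measurable[OF h] L' BM]
  define Mg where "Mg = (\<lambda>t \<omega>. Phi \<phi> (X t \<omega>) - Phi \<phi> (X 0 \<omega>) - ?I t \<omega>)"
  have zero: "(\<integral>\<omega>. indicator B \<omega> * (Mg t \<omega> - Mg s \<omega>) \<partial>M) = 0"
  proof -
    have "\<forall>s t. 0 \<le> s \<longrightarrow> s \<le> t \<longrightarrow> (\<forall>B \<in> sets (nat_filtration M X s).
             (\<integral>\<omega>. indicator B \<omega> * (Mg t \<omega> - Mg s \<omega>) \<partial>M) = 0)"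
      using sol \<phi> unfolding TFV_solution_def Mg_def Let_def by blast
    then show ?thesis using st B by blast
  qed
  have "(\<integral>\<omega>. indicator B \<omega> * (Mg t \<omega> - Mg s \<omega>) \<partial>M) =
     (\<integral>\<omega>. (indicator B \<omega> * Phi \<phi> (X t \<omega>) - indicator B \<omega> * Phi \<phi> (X s \<omega>))
       - (indicator B \<omega> * ?I' t \<omega> - indicator B \<omega> * ?I' s \<omega>) \<partial>M)"
    by (intro Bochner_Integration.integral_cong refl) (simp add: Mg_def I algebra_simps)
  also have "\<dots> = (\<integral>\<omega>. indicator B \<omega> * Phi \<phi> (X t \<omega>) - indicator B \<omega> * Phi \<phi> (X s \<omega>) \<partial>M)
    - (\<integral>\<omega>. indicator B \<omega> * ?I' t \<omega> - indicator B \<omega> * ?I' s \<omega> \<partial>M)"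
    using st by (intro Bochner_Integration.integral_diff Bochner_Integration.integrable_diff
        integrable_Phi[OF \<phi>'] swap_g(1) BM) auto
  finally have 1: "(\<integral>\<omega>. indicator B \<omega> * Phi \<phi> (X t \<omega>) - indicator B \<omega> * Phi \<phi> (X s \<omega>) \<partial>M) =
    (\<integral>\<omega>. indicator B \<omega> * ?I' t \<omega> - indicator B \<omega> * ?I' s \<omega> \<partial>M)"
    using zero by linarith
  have 2: "(\<integral>\<omega>. indicator B \<omega> * Phi \<phi> (X t \<omega>) - indicator B \<omega> * Phi \<phi> (X s \<omega>) \<partial>M) =
    (\<integral>\<omega>. indicator B \<omega> * Phi \<phi> (X t \<omega>) \<partial>M) - (\<integral>\<omega>. indicator B \<omega> * Phi \<phi> (X s \<omega>) \<partial>M)"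
    using st by (intro Bochner_Integration.integral_diff integrable_Phi[OF \<phi>'] BM) auto
  have 3: "(\<integral>\<omega>. indicator B \<omega> * ?I' t \<omega> - indicator B \<omega> * ?I' s \<omega> \<partial>M) =
    (LINT \<tau>:{0..t}|lborel. ?u ?g \<tau>) - (LINT \<tau>:{0..s}|lborel. ?u ?g \<tau>)"
    using Bochner_Integration.integral_diff[OF swap_g(1)[of 0 t] swap_g(1)[of 0 s]]
    by (simp only: swap_g(3)[of 0 t] swap_g(3)[of 0 s])
  have split: "{0..t} = {0..s} \<union> {s<..t}" using st by auto
  have 4: "(LINT \<tau>:{0..t}|lborel. ?u ?g \<tau>) = (LINT \<tau>:{0..s}|lborel. ?u ?g \<tau>) + (LINT \<tau>:{s<..t}|lborel. ?u ?g \<tau>)"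
    unfolding split using st
    by (intro set_integral_Un set_integrable_subset[OF swap_g(2)[of 0 t]]) auto
  have "(\<integral>\<omega>. indicator B \<omega> * Phi \<phi> (X t \<omega>) \<partial>M) = (\<integral>\<omega>. indicator B \<omega> * Phi \<phi> (X s \<omega>) \<partial>M)
    + (LINT \<tau>:{s<..t}|lborel. ?u ?g \<tau>)" using 1 2 3 4 by linarith
  moreover have "(LINT \<tau>:{s<..t}|lborel. ?u ?g \<tau>) \<le> (LINT \<tau>:{s<..t}|lborel. ?u h \<tau>)"
  proof (rule set_integral_mono)
    show "set_integrable lborel {s<..t} (?u ?g)" using st
      by (intro set_integrable_subset[OF swap_g(2)[of 0 t]]) auto
    show "set_integrable lborel {s<..t} (?u h)" using st
      by (intro set_integrable_subset[OF swap_h(2)[of 0 t]]) auto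
    show "?u ?g \<tau> \<le> ?u h \<tau>" for \<tau>
      by (intro integral_mono integrable_Phi[OF g] integrable_Phi[OF h])
        (auto simp: indicator_def le)
  qed
  ultimately show ?thesis by simp
qed

end

lemma set_integrable_const_Ioc: "set_integrable lborel {a<..b::real} (\<lambda>_. k :: real)"
  using borel_integrable_atLeastAtMost'[of a b "\<lambda>_. k"] by (rule set_integrable_subset) auto

lemma closure_Rats_Int_Ioo:
  assumes "a < (b::real)" shows "closure (\<rat> \<inter> {a<..<b}) = {a..b}"
proof
  have "x \<in> closure \<rat>" for x :: real
  proof (subst closure_approachable, intro allI impI)
    fix e :: real assume "0 < e"
    then obtain q where "q \<in> \<rat>" "x < q" "q < x + e" using Rats_dense_in_real[of x "x + e"] by auto
    then show "\<exists>y\<in>\<rat>. dist y x < e" by (intro bexI[of _ q]) (auto simp: dist_real_def)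
  qed
  then have "{a<..<b} \<subseteq> closure (\<rat> \<inter> {a<..<b})"
    using open_Int_closure_subset[of "{a<..<b}" \<rat>] by (auto simp: Int_commute)
  from closure_mono[OF this] show "{a..b} \<subseteq> closure (\<rat> \<inter> {a<..<b})" using assms by simp
  show "closure (\<rat> \<inter> {a<..<b}) \<subseteq> {a..b}" by (rule closure_minimal) auto
qed

context tree_valued_FV
begin

definition mean_pair :: "real \<Rightarrow> real \<Rightarrow> real" where
  "mean_pair c \<tau> = expectation (\<lambda>\<omega>. Phi (pair_decay c) (X (max 0 \<tau>) \<omega>))"

lemma bm_fun_pair_decay: "bm_fun 2 (pair_decay c :: _ \<times> (nat \<Rightarrow> 'a) \<Rightarrow> real)"
  using test_fun_pair_decay[of c, where 'a='a] by (simp add: test_fun_def bm_fun_def)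

lemma bm_fun_star_decay: "bm_fun 3 (star_decay c :: _ \<times> (nat \<Rightarrow> 'a) \<Rightarrow> real)"
  using test_fun_star_decay[of c, where 'a='a] by (simp add: test_fun_def bm_fun_def)

lemma bm_fun_affine_pair_decay: "bm_fun 2 (\<lambda>z :: _ \<times> (nat \<Rightarrow> 'a). a + b * pair_decay c z)"
proof -
  have "bounded_borel sample_space (\<lambda>z :: _ \<times> (nat \<Rightarrow> 'a). a + b * pair_decay c z)"
    by (intro bounded_borel_add bounded_borel_mult bounded_borel_const bounded_borel_pair_decay)
  moreover have "depends_first 2 (\<lambda>z :: _ \<times> (nat \<Rightarrow> 'a). a + b * pair_decay c z)"
    by (simp add: depends_first_def pair_decay_def)
  ultimately show ?thesis by (simp add: bm_fun_def bounded_borel_iff)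
qed

lemma Phi_affine_pair_decay:
  "0 \<le> t \<Longrightarrow> \<omega> \<in> space M \<Longrightarrow> Phi (\<lambda>z. a + b * pair_decay c z) (X t \<omega>) = a + b * Phi (pair_decay c) (X t \<omega>)"
  by (simp add: Phi_add[OF mmm] Phi_cmult[OF mmm] Phi_const[OF mmm] bounded_borel_mult bounded_borel_pair_decay)

lemma integrable_Phi_pair: "0 \<le> t \<Longrightarrow> integrable M (\<lambda>\<omega>. Phi (pair_decay c) (X t \<omega>))"
  using integrable_Phi[OF bm_fun_pair_decay[of c] _ sets.top, of t]
  by (subst Bochner_Integration.integrable_cong[OF refl, of M _ "\<lambda>\<omega>. indicator (space M) \<omega> * Phi (pair_decay c) (X t \<omega>)"]) auto

lemma integral_indicator_space: "(\<integral>\<omega>. indicator (space M) \<omega> * f \<omega> \<partial>M) = (\<integral>\<omega>. f \<omega> \<partial>M)" for f :: "'w \<Rightarrow> real"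
  by (intro Bochner_Integration.integral_cong) auto

lemma mean_pair_bounds:
  assumes "0 \<le> c" shows "0 \<le> mean_pair c \<tau>" "mean_pair c \<tau> \<le> 1"
proof -
  show "0 \<le> mean_pair c \<tau>" unfolding mean_pair_def
    using Phi_pair_decay_bounds(1)[OF mmm assms] by (intro integral_nonneg_AE AE_I2) auto
  show "mean_pair c \<tau> \<le> 1" unfolding mean_pair_def
    using Phi_pair_decay_bounds(2)[OF mmm assms] by (intro integral_le_const integrable_Phi_pair AE_I2) auto
qed

lemma mean_pair_integrable: "set_integrable lborel {a<..b} (mean_pair c)"
proof -
  obtain K where K: "\<And>t \<omega>. 0 \<le> t \<Longrightarrow> \<omega> \<in> space M \<Longrightarrow> \<bar>Phi (pair_decay c) (X t \<omega>)\<bar> \<le> K"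
    using Phi_bounded[OF bm_fun_pair_decay] by blast
  have K': "\<bar>Phi (pair_decay c) (X (max 0 \<tau>) \<omega>)\<bar> \<le> K" if "\<omega> \<in> space M" for \<tau> \<omega> using K that by simp
  have "set_integrable lborel {a..b} (mean_pair c)"
    using set_integral_expectation_swap(2)[OF Phi_jointly_measurable[OF bm_fun_pair_decay] K' sets.top, of a b]
    unfolding integral_indicator_space mean_pair_def[abs_def] by simp
  then show ?thesis by (rule set_integrable_subset) auto
qed

lemma mean_pair_integral_nonneg: "0 \<le> c \<Longrightarrow> 0 \<le> (LINT \<tau>:{a<..b}|lborel. mean_pair c \<tau>)"
  unfolding set_lebesgue_integral_def by (intro integral_nonneg_AE AE_I2) (simp add: mean_pair_bounds)

lemma mean_pair_integral_split:
  assumes "a \<le> b" "b \<le> d"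
  shows "(LINT \<tau>:{a<..d}|lborel. mean_pair c \<tau>) = (LINT \<tau>:{a<..b}|lborel. mean_pair c \<tau>) + (LINT \<tau>:{b<..d}|lborel. mean_pair c \<tau>)"
proof -
  have "{a<..d} = {a<..b} \<union> {b<..d}" using assms by auto
  then show ?thesis by (simp only:) (intro set_integral_Un mean_pair_integrable; auto)
qed

lemma mean_pair_integral_le:
  assumes c: "2 * \<alpha> < c" and "0 \<le> T"
  shows "(LINT \<tau>:{0<..T}|lborel. mean_pair c \<tau>) \<le> (T + 1) / (c - 2 * \<alpha>)"
proof -
  define \<kappa> where "\<kappa> = c - 2 * \<alpha>"
  have c0: "0 \<le> c" using c \<alpha> by linarith
  have "(\<integral>\<omega>. indicator (space M) \<omega> * Phi (pair_decay c) (X T \<omega>) \<partial>M) \<le>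
      (\<integral>\<omega>. indicator (space M) \<omega> * Phi (pair_decay c) (X 0 \<omega>) \<partial>M)
    + (LINT \<tau>:{0<..T}|lborel. \<integral>\<omega>. indicator (space M) \<omega> * Phi (\<lambda>z. 1 + - \<kappa> * pair_decay c z) (X (max 0 \<tau>) \<omega>) \<partial>M)"
  proof (rule expectation_drift_le[OF test_fun_pair_decay _ bm_fun_affine_pair_decay _ _ _ space_in_nat_filtration])
    show "Phi (gen_density \<alpha> fit (pair_decay c) 2) (X t \<omega>) \<le> Phi (\<lambda>z. 1 + - \<kappa> * pair_decay c z) (X t \<omega>)"
      if "0 \<le> t" "\<omega> \<in> space M" for t \<omega>
      using Phi_gen_density_pair_le[OF mmm[OF that] compact fit \<alpha> c0]
      by (simp add: \<kappa>_def[symmetric])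
  qed (use \<open>0 \<le> T\<close> in \<open>auto simp: pair_decay_def mutate_def\<close>)
  also have "(\<lambda>\<tau>. \<integral>\<omega>. indicator (space M) \<omega> * Phi (\<lambda>z. 1 + - \<kappa> * pair_decay c z) (X (max 0 \<tau>) \<omega>) \<partial>M)
    = (\<lambda>\<tau>. 1 - \<kappa> * mean_pair c \<tau>)"
  proof
    fix \<tau> :: real
    have "(\<integral>\<omega>. indicator (space M) \<omega> * Phi (\<lambda>z. 1 + - \<kappa> * pair_decay c z) (X (max 0 \<tau>) \<omega>) \<partial>M)
      = (\<integral>\<omega>. 1 + - \<kappa> * Phi (pair_decay c) (X (max 0 \<tau>) \<omega>) \<partial>M)"
      by (intro Bochner_Integration.integral_cong refl) (simp only: Phi_affine_pair_decay max.cobounded1 indicator_simps mult_1)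
    also have "\<dots> = 1 - \<kappa> * mean_pair c \<tau>"
      by (subst Bochner_Integration.integral_add) (auto simp: mean_pair_def prob_space intro!: integrable_Phi_pair)
    finally show "(\<integral>\<omega>. indicator (space M) \<omega> * Phi (\<lambda>z. 1 + - \<kappa> * pair_decay c z) (X (max 0 \<tau>) \<omega>) \<partial>M)
      = 1 - \<kappa> * mean_pair c \<tau>" .
  qed
  also have "(LINT \<tau>:{0<..T}|lborel. 1 - \<kappa> * mean_pair c \<tau>) = T - \<kappa> * (LINT \<tau>:{0<..T}|lborel. mean_pair c \<tau>)"
  proof -
    have "set_integrable lborel {0<..T} (\<lambda>_. 1 :: real)"
      by (rule set_integrable_const_Ioc)
    then have "(LINT \<tau>:{0<..T}|lborel. 1 - \<kappa> * mean_pair c \<tau>) =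
      (LINT \<tau>:{0<..T}|lborel. 1) - (LINT \<tau>:{0<..T}|lborel. \<kappa> * mean_pair c \<tau>)"
      by (intro set_integral_diff(2) set_integrable_mult_right mean_pair_integrable)
    then show ?thesis using \<open>0 \<le> T\<close> by (simp add: set_lebesgue_integral_def mult.left_commute)
  qed
  finally have "mean_pair c T \<le> mean_pair c 0 + (T - \<kappa> * (LINT \<tau>:{0<..T}|lborel. mean_pair c \<tau>))"
    using \<open>0 \<le> T\<close> by (simp only: integral_indicator_space mean_pair_def max_absorb2 order_refl)
  then have "(LINT \<tau>:{0<..T}|lborel. mean_pair c \<tau>) * \<kappa> \<le> T + 1"
    using mean_pair_bounds(1)[OF c0, of T] mean_pair_bounds(2)[OF c0, of 0] by (simp only: mult.commute[of _ \<kappa>])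
  then show ?thesis using c by (subst pos_le_divide_eq) (auto simp: \<kappa>_def)
qed

lemma star_decay_drift:
  assumes c: "0 \<le> c" and st: "0 \<le> s" "s \<le> t" and B: "B \<in> sets (nat_filtration M X s)"
  shows "(\<integral>\<omega>. indicator B \<omega> * Phi (star_decay c) (X t \<omega>) \<partial>M) \<le> (\<integral>\<omega>. indicator B \<omega> * Phi (star_decay c) (X s \<omega>) \<partial>M)
    + (3 + 3 * \<alpha>) * (LINT \<tau>:{s<..t}|lborel. mean_pair c \<tau>)"
proof -
  let ?h = "\<lambda>z. 0 + (3 + 3 * \<alpha>) * pair_decay c z"
  let ?u = "\<lambda>\<tau>. \<integral>\<omega>. indicator B \<omega> * Phi ?h (X (max 0 \<tau>) \<omega>) \<partial>M"
  have BM: "B \<in> events" using B nat_filtration_subset by blast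
  have "(\<integral>\<omega>. indicator B \<omega> * Phi (star_decay c) (X t \<omega>) \<partial>M) \<le> (\<integral>\<omega>. indicator B \<omega> * Phi (star_decay c) (X s \<omega>) \<partial>M)
    + (LINT \<tau>:{s<..t}|lborel. ?u \<tau>)"
  proof (rule expectation_drift_le[OF test_fun_star_decay _ bm_fun_affine_pair_decay _ st B])
    show "Phi (gen_density \<alpha> fit (star_decay c) 3) (X t \<omega>) \<le> Phi ?h (X t \<omega>)"
      if "0 \<le> t" "\<omega> \<in> space M" for t \<omega>
      unfolding Phi_affine_pair_decay[OF that]
      using Phi_gen_density_star_le[OF mmm[OF that] compact fit \<alpha> c] by simp
  qed (auto simp: star_decay_def mutate_def)
  moreover have "(LINT \<tau>:{s<..t}|lborel. ?u \<tau>) \<le> (LINT \<tau>:{s<..t}|lborel. (3 + 3 * \<alpha>) * mean_pair c \<tau>)"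
  proof (cases "set_integrable lborel {s<..t} ?u")
    case True
    then show ?thesis
    proof (rule set_integral_mono)
      show "set_integrable lborel {s<..t} (\<lambda>\<tau>. (3 + 3 * \<alpha>) * mean_pair c \<tau>)"
        by (intro set_integrable_mult_right mean_pair_integrable)
      fix \<tau> :: real
      have "?u \<tau> \<le> (\<integral>\<omega>. (3 + 3 * \<alpha>) * Phi (pair_decay c) (X (max 0 \<tau>) \<omega>) \<partial>M)"
      proof (rule integral_mono[OF integrable_Phi[OF bm_fun_affine_pair_decay _ BM]])
        show "integrable M (\<lambda>\<omega>. (3 + 3 * \<alpha>) * Phi (pair_decay c) (X (max 0 \<tau>) \<omega>))"
          by (intro integrable_mult_right integrable_Phi_pair) simp
        show "indicator B \<omega> * Phi ?h (X (max 0 \<tau>) \<omega>) \<le> (3 + 3 * \<alpha>) * Phi (pair_decay c) (X (max 0 \<tau>) \<omega>)"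
          if "\<omega> \<in> space M" for \<omega>
          unfolding Phi_affine_pair_decay[OF max.cobounded1 that]
          using Phi_pair_decay_bounds(1)[OF mmm[OF max.cobounded1 that] c, of \<tau>] \<alpha> by (simp add: indicator_def)
      qed simp
      then show "?u \<tau> \<le> (3 + 3 * \<alpha>) * mean_pair c \<tau>" by (simp add: mean_pair_def)
    qed
  next
    case False
    then have "(LINT \<tau>:{s<..t}|lborel. ?u \<tau>) = 0"
      unfolding set_lebesgue_integral_def set_integrable_def by (rule not_integrable_integral_eq)
    then show ?thesis using mean_pair_integral_nonneg[OF c, of s t] \<alpha> by simp
  qed
  ultimately show ?thesis by simp
qed

lemma star_decay_maximal_finite:
  assumes c: "2 * \<alpha> < c" and \<epsilon>: "0 < \<epsilon>" "\<epsilon> \<le> T" and \<delta>: "0 < \<delta>" and S: "finite S" "S \<subseteq> {\<epsilon>..T}"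
  shows "prob {\<omega>\<in>space M. \<exists>t\<in>S. \<delta> \<le> Phi (star_decay c) (X t \<omega>)}
    \<le> (1 + \<epsilon> * (3 + 3 * \<alpha>)) * (T + 1) / (\<epsilon> * \<delta> * (c - 2 * \<alpha>))"
proof -
  let ?E = "{\<omega>\<in>space M. \<exists>t\<in>S. \<delta> \<le> Phi (star_decay c) (X t \<omega>)}"
  let ?I = "\<lambda>t. LINT \<tau>:{0<..t}|lborel. mean_pair c \<tau>"
  define J where "J t = (3 + 3 * \<alpha>) * ?I t" for t
  have c0: "0 \<le> c" using c \<alpha> by linarith
  have J_diff: "J t - J s = (3 + 3 * \<alpha>) * (LINT \<tau>:{s<..t}|lborel. mean_pair c \<tau>)" if "0 \<le> s" "s \<le> t" for s t
    using mean_pair_integral_split[OF that, of c] by (simp add: J_def algebra_simps)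
  have J_mono: "J s \<le> J t" if "0 \<le> s" "s \<le> t" for s t
    using J_diff[OF that] mean_pair_integral_nonneg[OF c0, of s t] \<alpha>
    by (metis add_nonneg_nonneg diff_ge_0_iff_ge mult_nonneg_nonneg zero_le_numeral)
  have J0: "J 0 = 0" by (simp add: J_def set_lebesgue_integral_def)
  have bound: "\<delta> * prob ?E - J T \<le> mean_pair c s" if s: "s \<in> {0<..\<epsilon>}" for s
  proof -
    have "\<delta> * prob (space M \<inter> {\<omega>\<in>space M. \<exists>t\<in>set (sorted_list_of_set S). \<delta> \<le> Phi (star_decay c) (X t \<omega>)})
      \<le> (\<integral>\<omega>. indicator (space M) \<omega> * Phi (star_decay c) (X s \<omega>) \<partial>M) + (J T - J s)"
    proof (rule maximal_inequality_finite[where F="\<lambda>t. sets (nat_filtration M X t)" and K=1])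
      show "Phi (star_decay c) (X t \<omega>) \<le> 1" if "0 \<le> t" "\<omega> \<in> space M" for t \<omega>
        using Phi_star_decay_bounds(2)[OF mmm[OF that] c0] Phi_pair_decay_bounds(2)[OF mmm[OF that] c0] by linarith
      show "(\<integral>\<omega>. indicator B \<omega> * Phi (star_decay c) (X t \<omega>) \<partial>M) \<le>
        (\<integral>\<omega>. indicator B \<omega> * Phi (star_decay c) (X s \<omega>) \<partial>M) + (J t - J s)"
        if "0 \<le> s" "s \<le> t" "B \<in> sets (nat_filtration M X s)" for s t B
        using star_decay_drift[OF c0 that] J_diff[OF that(1,2)] by linarith
      show "B \<inter> {\<omega>\<in>space M. Phi (star_decay c) (X t \<omega>) < \<delta>} \<in> sets (nat_filtration M X t)"
        if "0 \<le> t" "B \<in> sets (nat_filtration M X t)" for t B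
        by (rule level_in_nat_filtration[OF that(1) test_fun_star_decay that(2)])
      show "B \<in> events" if "B \<in> sets (nat_filtration M X t)" for t B
        using that nat_filtration_subset by blast
      show "B \<in> sets (nat_filtration M X t)" if "s \<le> t" "B \<in> sets (nat_filtration M X s)" for s t B
        using that nat_filtration_mono by blast
      show "sorted (s # sorted_list_of_set S)" using s S by fastforce
      show "\<And>t. t \<in> set (sorted_list_of_set S) \<Longrightarrow> t \<le> T" using S by auto
    qed (use s \<epsilon> \<delta> J_mono prob_space_axioms
        Phi_star_decay_bounds(1)[OF mmm c0] space_in_nat_filtration Phi_measurable[OF bm_fun_star_decay] in auto)
    moreover have "space M \<inter> {\<omega>\<in>space M. \<exists>t\<in>set (sorted_list_of_set S). \<delta> \<le> Phi (star_decay c) (X t \<omega>)} = ?E"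
      using S(1) by auto
    moreover have "(\<integral>\<omega>. indicator (space M) \<omega> * Phi (star_decay c) (X s \<omega>) \<partial>M) \<le> mean_pair c s"
    proof -
      have "(\<integral>\<omega>. indicator (space M) \<omega> * Phi (star_decay c) (X s \<omega>) \<partial>M) \<le> (\<integral>\<omega>. Phi (pair_decay c) (X s \<omega>) \<partial>M)"
        using s Phi_star_decay_bounds(2)[OF mmm c0, of s]
        by (intro integral_mono integrable_Phi[OF bm_fun_star_decay] integrable_Phi_pair) auto
      then show ?thesis using s by (simp add: mean_pair_def max_absorb2)
    qed
    moreover have "0 \<le> J s" using J_mono[of 0 s] s J0 by simp
    ultimately show ?thesis by simp
  qed
  have "(LINT \<tau>:{0<..\<epsilon>}|lborel. \<delta> * prob ?E - J T) \<le> ?I \<epsilon>"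
    by (rule set_integral_mono[OF set_integrable_const_Ioc mean_pair_integrable bound])
  also have "(LINT \<tau>:{0<..\<epsilon>}|lborel. \<delta> * prob ?E - J T) = \<epsilon> * (\<delta> * prob ?E - J T)"
    using \<epsilon> by (simp add: set_lebesgue_integral_def)
  also have "?I \<epsilon> \<le> ?I T"
    using mean_pair_integral_split[of 0 \<epsilon> T c] mean_pair_integral_nonneg[OF c0, of \<epsilon> T] \<epsilon> by linarith
  finally have "\<epsilon> * \<delta> * prob ?E \<le> (1 + \<epsilon> * (3 + 3 * \<alpha>)) * ?I T"
    by (simp add: J_def algebra_simps)
  also have "\<dots> \<le> (1 + \<epsilon> * (3 + 3 * \<alpha>)) * ((T + 1) / (c - 2 * \<alpha>))"
    using \<epsilon> \<alpha> by (intro mult_left_mono mean_pair_integral_le[OF c]) auto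
  finally have "prob ?E * (\<epsilon> * \<delta>) \<le> (1 + \<epsilon> * (3 + 3 * \<alpha>)) * (T + 1) / (c - 2 * \<alpha>)"
    by (simp add: mult.commute)
  then have "prob ?E \<le> (1 + \<epsilon> * (3 + 3 * \<alpha>)) * (T + 1) / (c - 2 * \<alpha>) / (\<epsilon> * \<delta>)"
    using \<epsilon> \<delta> by (subst pos_le_divide_eq) auto
  then show ?thesis by (simp add: mult.commute)
qed

lemma star_decay_maximal_rational:
  assumes c: "2 * \<alpha> < c" and \<epsilon>: "0 < \<epsilon>" "\<epsilon> \<le> T" and \<delta>: "0 < \<delta>"
  shows "{\<omega>\<in>space M. \<exists>t\<in>\<rat> \<inter> {\<epsilon>..T}. \<delta> \<le> Phi (star_decay c) (X t \<omega>)} \<in> events" (is "?E \<in> _")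
    and "prob {\<omega>\<in>space M. \<exists>t\<in>\<rat> \<inter> {\<epsilon>..T}. \<delta> \<le> Phi (star_decay c) (X t \<omega>)}
      \<le> (1 + \<epsilon> * (3 + 3 * \<alpha>)) * (T + 1) / (\<epsilon> * \<delta> * (c - 2 * \<alpha>))" (is "_ \<le> ?R")
proof -
  let ?L = "\<lambda>t. {\<omega>\<in>space M. \<delta> \<le> Phi (star_decay c) (X t \<omega>)}"
  have L: "?L t \<in> events" if "t \<in> {\<epsilon>..T}" for t
    using Phi_measurable[OF bm_fun_star_decay[of c], of t] that \<epsilon> by simp
  have count: "countable (\<rat> \<inter> {\<epsilon>..T})" using countable_rat by blast
  have E: "?E = (\<Union>t\<in>\<rat> \<inter> {\<epsilon>..T}. ?L t)" by auto
  show "?E \<in> events" unfolding E using L count by (intro sets.countable_UN') auto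
  show "prob ?E \<le> ?R"
  proof (cases "\<rat> \<inter> {\<epsilon>..T} = {}")
    case True
    then have "prob ?E = 0" by (simp add: E)
    then show ?thesis using c \<epsilon> \<delta> \<alpha> by simp
  next
    case False
    define q where "q = from_nat_into (\<rat> \<inter> {\<epsilon>..T})"
    have q: "range q = \<rat> \<inter> {\<epsilon>..T}" using range_from_nat_into[OF False count] by (simp add: q_def)
    let ?A = "\<lambda>n. \<Union>t\<in>q ` {..n}. ?L t"
    have "q i \<in> {\<epsilon>..T}" for i using q by blast
    then have "range ?A \<subseteq> events" using L by (intro image_subsetI sets.finite_UN) auto
    moreover have "incseq ?A" by (intro monoI UN_mono) auto
    ultimately have "(\<lambda>n. prob (?A n)) \<longlonglongrightarrow> prob (\<Union>n. ?A n)"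
      by (rule finite_Lim_measure_incseq)
    moreover have "(\<Union>n. ?A n) = ?E" unfolding E q[symmetric] by auto
    moreover have "prob (?A n) \<le> ?R" for n
    proof -
      have "?A n = {\<omega>\<in>space M. \<exists>t\<in>q ` {..n}. \<delta> \<le> Phi (star_decay c) (X t \<omega>)}" by auto
      then show ?thesis
        using star_decay_maximal_finite[OF assms, of "q ` {..n}"] \<open>\<And>i. q i \<in> {\<epsilon>..T}\<close>
        by (simp add: image_subset_iff)
    qed
    ultimately show ?thesis by (metis (no_types, lifting) LIMSEQ_le_const2)
  qed
qed

lemma AE_star_decay_small:
  assumes \<epsilon>: "0 < \<epsilon>" "\<epsilon> < T" and \<delta>: "0 < \<delta>"
  shows "AE \<omega> in M. \<exists>c\<ge>0. \<forall>t\<in>{\<epsilon>..T}. Phi (star_decay c) (X t \<omega>) \<le> \<delta>"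
proof -
  let ?E = "\<lambda>n::nat. {\<omega>\<in>space M. \<exists>t\<in>\<rat> \<inter> {\<epsilon>..T}. \<delta> \<le> Phi (star_decay (2 * \<alpha> + 1 + n)) (X t \<omega>)}"
  let ?C = "(1 + \<epsilon> * (3 + 3 * \<alpha>)) * (T + 1) / (\<epsilon> * \<delta>)"
  have E: "?E n \<in> events" "prob (?E n) \<le> ?C * inverse (real (Suc n))" for n
    using star_decay_maximal_rational[of "2 * \<alpha> + 1 + real n" \<epsilon> T \<delta>] assms
    by (simp_all add: divide_simps add.commute)
  have N: "(\<Inter>n. ?E n) \<in> events" using E(1) by (intro sets.countable_INT) auto
  have "prob (\<Inter>n. ?E n) \<le> ?C * inverse (real (Suc n))" for n
  proof -
    have "prob (\<Inter>n. ?E n) \<le> prob (?E n)" by (rule finite_measure_mono[OF _ E(1)]) blast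
    also note E(2)
    finally show ?thesis .
  qed
  moreover have "(\<lambda>n. ?C * inverse (real (Suc n))) \<longlonglongrightarrow> ?C * 0"
    by (intro tendsto_mult_left LIMSEQ_inverse_real_of_nat)
  ultimately have "prob (\<Inter>n. ?E n) \<le> 0"
    using LIMSEQ_le_const[of _ "?C * 0" "prob (\<Inter>n. ?E n)"] by simp
  then have "(\<Inter>n. ?E n) \<in> null_sets M"
    using N by (simp add: null_sets_def emeasure_eq_measure measure_le_0_iff)
  then have "AE \<omega> in M. \<omega> \<notin> (\<Inter>n. ?E n)" by (rule AE_not_in)
  moreover have "AE \<omega> in M. \<forall>n (\<phi> :: _ \<times> (nat \<Rightarrow> 'a) \<Rightarrow> real). cont_fun n \<phi> \<longrightarrow> continuous_on {0..} (\<lambda>t. Phi \<phi> (X t \<omega>))"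
    using sol unfolding TFV_solution_def by blast
  moreover have "AE \<omega> in M. \<omega> \<in> space M" by (rule AE_space)
  ultimately show ?thesis
  proof eventually_elim
    case (elim \<omega>)
    then obtain n where n: "\<omega> \<notin> ?E n" by blast
    define c where "c = 2 * \<alpha> + 1 + real n"
    let ?f = "\<lambda>t. Phi (star_decay c) (X t \<omega>)"
    have "continuous_on {0..} ?f" using elim(2) cont_fun_star_decay by blast
    then have cont: "continuous_on {\<epsilon>..T} ?f" by (rule continuous_on_subset) (use \<epsilon> in auto)
    have closure: "closure (\<rat> \<inter> {\<epsilon><..<T}) = {\<epsilon>..T}"
      by (rule closure_Rats_Int_Ioo) (use \<epsilon> in simp)
    have "?f t \<le> \<delta>" if "t \<in> {\<epsilon>..T}" for t
    proof (rule continuous_le_on_closure[of "\<rat> \<inter> {\<epsilon><..<T}" ?f])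
      show "?f q \<le> \<delta>" if "q \<in> \<rat> \<inter> {\<epsilon><..<T}" for q
        using n elim(3) that by (force simp: c_def)
    qed (use closure cont that in auto)
    then show ?case using \<alpha> by (intro exI[of _ c]) (auto simp: c_def)
  qed
qed

lemma AE_no_atoms: "AE \<omega> in M. \<forall>t>0. no_atoms (X t \<omega>)"
proof -
  have "AE \<omega> in M. \<forall>m k::nat. \<exists>c\<ge>0. \<forall>t\<in>{1 / (real m + 2)..real m + 2}. Phi (star_decay c) (X t \<omega>) \<le> 1 / real (Suc k)"
    unfolding AE_all_countable
  proof (intro allI AE_star_decay_small)
    show "1 / (real m + 2) < real m + 2" for m
      by (simp add: divide_less_eq) (smt (verit) mult_less_cancel_left2 of_nat_0_le_iff)
  qed auto
  moreover have "AE \<omega> in M. \<omega> \<in> space M" by (rule AE_space)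
  ultimately show ?thesis
  proof eventually_elim
    case (elim \<omega>)
    show ?case
    proof (intro allI impI)
      fix t :: real assume t: "0 < t"
      obtain m :: nat where m: "max t (1 / t) \<le> real m" using real_arch_simple by blast
      have "1 / t \<le> real m + 2" using m by simp
      then have "1 / (real m + 2) \<le> t" using t by (simp add: field_simps)
      then have mt: "t \<in> {1 / (real m + 2)..real m + 2}" using m by simp
      show "no_atoms (X t \<omega>)"
      proof (rule no_atoms_if_star_decay_small[OF mmm])
        fix \<delta> :: real assume "0 < \<delta>"
        then obtain k where "inverse (real (Suc k)) < \<delta>" using reals_Archimedean by blast
        moreover obtain c where "0 \<le> c" "Phi (star_decay c) (X t \<omega>) \<le> 1 / real (Suc k)"
          using elim(1) mt by meson
        ultimately show "\<exists>c\<ge>0. Phi (star_decay c) (X t \<omega>) \<le> \<delta>"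
          by (intro exI[of _ c]) (simp add: inverse_eq_divide)
      qed (use t elim in auto)
    qed
  qed
qed

end

theorem theorem5:
  fixes M :: "'w measure"
    and X :: "real \<Rightarrow> 'w \<Rightarrow> ('u \<Rightarrow> 'u \<Rightarrow> real) \<times> ('u \<times> 'a::metric_space) measure"
    and \<theta> \<alpha> :: real
    and \<beta> :: "'a \<Rightarrow> 'a measure"
    and fit :: "'a \<Rightarrow> 'a \<Rightarrow> real \<Rightarrow> real"
  assumes "compact (UNIV :: 'a set)"
    and "\<theta> \<ge> 0"
    and "\<beta> \<in> borel \<rightarrow>\<^sub>M prob_algebra borel"
    and "\<alpha> \<ge> 0"
    and "fitness_fun fit"
    and "TFV_solution M \<theta> \<beta> \<alpha> fit X"
  shows "AE \<omega> in M. \<forall>t>0. no_atoms (X t \<omega>)"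
proof -
  interpret tree_valued_FV M X \<theta> \<alpha> \<beta> fit
    using assms by unfold_locales
  show ?thesis by (rule AE_no_atoms)
qed

end
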